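(* Fix $\theta\in\mathbb{R}$, $\tau\ge 0$ and $q\in(-1,1)$, and let $t>0$. (i) Let $f:\mathbb{R}\to\mathbb{R}$ be a bounded continuous function with bounded continuous second derivative. Then $f\in\mathcal{D}_t^-\cap\mathcal{D}_t^+$, both weak infinitesimal generators coincide on $f$, and for every $x\in\mathbb{R}$ $$\mathbb{A}_t^{\pm}(f)(x)=\frac12 f''(x)\,\nu_{x,t}(\{x\})+\int_{\mathbb{R}\setminus\{x\}}\left(\frac{\partial}{\partial x}\frac{f(y)-f(x)}{y-x}\right)\nu_{x,t}(dy).\qquad( * )$$ (ii) If $f$ is a polynomial, then the left and right infinitesimal generators $\widetilde{\mathbb{A}}_t^{\pm}$ on polynomials coincide on $f$, and $\widetilde{\mathbb{A}}_t^{\pm}(f)(x)$ is given by the right-hand side of $( * )$. On polynomials this expression takes the form $$\widetilde{\mathbb{A}}_t^{\pm}(f)(x)=\int_{\mathbb{R}}\left(\frac{\partial}{\partial x}\frac{f(y)-f(x)}{y-x}\right)\nu_{x,t}(dy).$$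
   Context: Notation: $[n]_q=\sum_{j=0}^{n-1}q^j$ (so $[0]_q=0$). Transition probabilities. For $0\le s<t$ and $x\in\mathbb{R}$, let $Q_n(y|x,s,t)$ be the polynomials in $y$ given by $Q_{-1}=0$, $Q_0=1$, $Q_1(y|x,s,t)=y-x$ and, for $n\ge1$, $$yQ_n(y|x,s,t)=Q_{n+1}(y|x,s,t)+(\theta[n]_q+xq^n)Q_n(y|x,s,t)+(t-sq^{n-1}+\tau[n-1]_q)[n]_qQ_{n-1}(y|x,s,t).$$ $P_{s,t}(x,dy)$ is the unique probability measure with respect to which these polynomials are orthogonal; the family $\{P_{s,t}(x,dy)\}$ is the family of transition probabilities of a (non-homogeneous) Markov process, the $q$-Meixner process with parameters $\theta,\tau,q$. Write $(\mathsf{P}_{s,t}f)(x)=\int f(y)P_{s,t}(x,dy)$, for $f$ in the space $C_b(\mathbb{R})$ of bounded continuous functions (with sup norm $\|\cdot\|_\infty$) or for $f$ a polynomial. Weak generators. For $t>0$, $\mathcal{D}_t^-$ (resp. $\mathcal{D}_t^+$) is the set of $f\in C_b(\mathbb{R})$ such that the limit $\mathbb{A}_t^-f=\lim_{h\to0^+}\frac1h(\mathsf{P}_{t-h,t}f-f)$ (resp. $\mathbb{A}_t^+f=\lim_{h\to0^+}\frac1h(\mathsf{P}_{t,t+h}f-f)$) exists pointwise on $\mathbb{R}$ and the sup norm $\left\|\frac1h(\mathsf{P}_{t-h,t}f-f)\right\|_\infty$ (resp. $\left\|\frac1h(\mathsf{P}_{t,t+h}f-f)\right\|_\infty$) is bounded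 in $h$. $\mathbb{A}_t^-$ and $\mathbb{A}_t^+$ are the weak left and weak right infinitesimal generators. Generators on polynomials. $\widetilde{\mathbb{A}}_t^-$ and $\widetilde{\mathbb{A}}_t^+$ are the linear operators on polynomials defined by the same two limits, taken pointwise, with no boundedness requirement. The measure $\nu_{x,t}$. For $x\in\mathbb{R}$, $t>0$, $\nu_{x,t}(dy)$ is the (compactly supported, unique) probability measure with respect to which the following monic polynomials in $y$ are orthogonal: $W_{-1}=0$, $W_0=1$, and for $n\ge0$ $$yW_n(y;x,t)=W_{n+1}(y;x,t)+(\theta[n+1]_q+xq^{n+1})W_n(y;x,t)+((1-q)t+\tau)[n]_q[n+1]_qW_{n-1}(y;x,t).$$ For a polynomial $f$, $\frac{f(y)-f(x)}{y-x}$ denotes the corresponding polynomial in $x,y$ (so it and its $x$-derivative are also defined at $y=x$). *)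

theory Defs
  imports "HOL-Probability.Probability" "HOL-Computational_Algebra.Polynomial"
begin

definition q_nat :: "real \<Rightarrow> nat \<Rightarrow> real" where
  "q_nat q n = (\<Sum>j<n. q ^ j)"

(* Both recursions are solved for the polynomial of highest index; the case Suc (Suc n)
   is y p_{n+1}(y) = p_{n+2}(y) + ... . *)

fun Q_poly :: "real \<Rightarrow> real \<Rightarrow> real \<Rightarrow> real \<Rightarrow> real \<Rightarrow> real \<Rightarrow> nat \<Rightarrow> real poly" where
  "Q_poly \<theta> \<tau> q x s t 0 = 1"
| "Q_poly \<theta> \<tau> q x s t (Suc 0) = [:- x, 1:]"
| "Q_poly \<theta> \<tau> q x s t (Suc (Suc n)) =
     [:- (\<theta> * q_nat q (n + 1) + x * q ^ (n + 1)), 1:] * Q_poly \<theta> \<tau> q x s t (Suc n)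
     - smult ((t - s * q ^ n + \<tau> * q_nat q n) * q_nat q (n + 1)) (Q_poly \<theta> \<tau> q x s t n)"

fun W_poly :: "real \<Rightarrow> real \<Rightarrow> real \<Rightarrow> real \<Rightarrow> real \<Rightarrow> nat \<Rightarrow> real poly" where
  "W_poly \<theta> \<tau> q x t 0 = 1"
| "W_poly \<theta> \<tau> q x t (Suc 0) = [:- (\<theta> * q_nat q 1 + x * q), 1:]"
| "W_poly \<theta> \<tau> q x t (Suc (Suc n)) =
     [:- (\<theta> * q_nat q (n + 2) + x * q ^ (n + 2)), 1:] * W_poly \<theta> \<tau> q x t (Suc n)
     - smult (((1 - q) * t + \<tau>) * q_nat q (n + 1) * q_nat q (n + 2)) (W_poly \<theta> \<tau> q x t n)"

(* Integrability is required explicitly because the Bochner integral of a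
   non-integrable function is 0 by convention. *)

definition orthogonality_measure :: "(nat \<Rightarrow> real poly) \<Rightarrow> real measure \<Rightarrow> bool" where
  "orthogonality_measure p \<mu> \<longleftrightarrow>
     prob_space \<mu> \<and> sets \<mu> = sets borel \<and>
     (\<forall>m n. integrable \<mu> (\<lambda>y. poly (p m) y * poly (p n) y)) \<and>
     (\<forall>m n. m \<noteq> n \<longrightarrow> (LINT y|\<mu>. poly (p m) y * poly (p n) y) = 0)"

definition trans_prob :: "real \<Rightarrow> real \<Rightarrow> real \<Rightarrow> real \<Rightarrow> real \<Rightarrow> real \<Rightarrow> real measure" where
  "trans_prob \<theta> \<tau> q s t x = (THE \<mu>. orthogonality_measure (Q_poly \<theta> \<tau> q x s t) \<mu>)"

definition nu_measure :: "real \<Rightarrow> real \<Rightarrow> real \<Rightarrow> real \<Rightarrow> real \<Rightarrow> real measure" where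
  "nu_measure \<theta> \<tau> q x t = (THE \<mu>. orthogonality_measure (W_poly \<theta> \<tau> q x t) \<mu>)"

definition trans_op ::
    "real \<Rightarrow> real \<Rightarrow> real \<Rightarrow> real \<Rightarrow> real \<Rightarrow> (real \<Rightarrow> real) \<Rightarrow> real \<Rightarrow> real" where
  "trans_op \<theta> \<tau> q s t f x = (LINT y|trans_prob \<theta> \<tau> q s t x. f y)"

definition left_quot ::
    "real \<Rightarrow> real \<Rightarrow> real \<Rightarrow> real \<Rightarrow> (real \<Rightarrow> real) \<Rightarrow> real \<Rightarrow> real \<Rightarrow> real" where
  "left_quot \<theta> \<tau> q t f h x = (1 / h) * (trans_op \<theta> \<tau> q (t - h) t f x - f x)"

definition right_quot ::
    "real \<Rightarrow> real \<Rightarrow> real \<Rightarrow> real \<Rightarrow> (real \<Rightarrow> real) \<Rightarrow> real \<Rightarrow> real \<Rightarrow> real" where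
  "right_quot \<theta> \<tau> q t f h x = (1 / h) * (trans_op \<theta> \<tau> q t (t + h) f x - f x)"

(* The pointwise limits defining the generators, both the weak ones (for f in the domains
   below) and those on polynomials. The values are meaningful only where the limit exists. *)

definition left_gen ::
    "real \<Rightarrow> real \<Rightarrow> real \<Rightarrow> real \<Rightarrow> (real \<Rightarrow> real) \<Rightarrow> real \<Rightarrow> real" where
  "left_gen \<theta> \<tau> q t f x = Lim (at_right 0) (\<lambda>h. left_quot \<theta> \<tau> q t f h x)"

definition right_gen ::
    "real \<Rightarrow> real \<Rightarrow> real \<Rightarrow> real \<Rightarrow> (real \<Rightarrow> real) \<Rightarrow> real \<Rightarrow> real" where
  "right_gen \<theta> \<tau> q t f x = Lim (at_right 0) (\<lambda>h. right_quot \<theta> \<tau> q t f h x)"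

(* Extended-real valued, so that an unbounded function has norm \<infinity>. *)

definition sup_norm :: "(real \<Rightarrow> real) \<Rightarrow> ereal" where
  "sup_norm g = (SUP x. ereal \<bar>g x\<bar>)"

(* Boundedness in h is over all admissible h: transition probabilities P_{s,t} exist
   for 0 <= s < t. *)

definition left_dom :: "real \<Rightarrow> real \<Rightarrow> real \<Rightarrow> real \<Rightarrow> (real \<Rightarrow> real) set" where
  "left_dom \<theta> \<tau> q t = {f. continuous_on UNIV f \<and> bounded (range f) \<and>
     (\<forall>x. \<exists>L. ((\<lambda>h. left_quot \<theta> \<tau> q t f h x) \<longlongrightarrow> L) (at_right 0)) \<and>
     (\<exists>C::real. \<forall>h\<in>{0<..t}. sup_norm (left_quot \<theta> \<tau> q t f h) \<le> ereal C)}"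

definition right_dom :: "real \<Rightarrow> real \<Rightarrow> real \<Rightarrow> real \<Rightarrow> (real \<Rightarrow> real) set" where
  "right_dom \<theta> \<tau> q t = {f. continuous_on UNIV f \<and> bounded (range f) \<and>
     (\<forall>x. \<exists>L. ((\<lambda>h. right_quot \<theta> \<tau> q t f h x) \<longlongrightarrow> L) (at_right 0)) \<and>
     (\<exists>C::real. \<forall>h\<in>{0<..}. sup_norm (right_quot \<theta> \<tau> q t f h) \<le> ereal C)}"

(* The x-derivative of (f(y) - f(x)) / (y - x) for y \<noteq> x; not meaningful at y = x. *)

definition dd_deriv :: "(real \<Rightarrow> real) \<Rightarrow> real \<Rightarrow> real \<Rightarrow> real" where
  "dd_deriv f x y = deriv (\<lambda>z. (f y - f z) / (y - z)) x"

definition gen_formula ::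
    "real \<Rightarrow> real \<Rightarrow> real \<Rightarrow> real \<Rightarrow> (real \<Rightarrow> real) \<Rightarrow> real \<Rightarrow> real" where
  "gen_formula \<theta> \<tau> q t f x =
     (1 / 2) * deriv (deriv f) x * measure (nu_measure \<theta> \<tau> q x t) {x}
     + (LINT y:(- {x})|nu_measure \<theta> \<tau> q x t. dd_deriv f x y)"

(* For fixed y, (f(y) - f(x)) / (y - x) as a polynomial in x (the division is exact);
   its x-derivative makes sense at y = x as well. *)

definition dd_poly :: "real poly \<Rightarrow> real \<Rightarrow> real poly" where
  "dd_poly f y = ([:poly f y:] - f) div [:y, - 1:]"

definition dd_poly_deriv :: "real poly \<Rightarrow> real \<Rightarrow> real \<Rightarrow> real" where
  "dd_poly_deriv f x y = poly (pderiv (dd_poly f y)) x"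

end

theory Submission
  imports Defs "HOL-Computational_Algebra.Fundamental_Theorem_Algebra"
begin

text \<open>
  Fix \<open>x\<close> and let \<open>s < t\<close>. The measure \<open>P\<^sub>s\<^sub>,\<^sub>t(x, dy)\<close> has mean \<open>x\<close> and variance \<open>t - s\<close>, because
  \<open>Q\<^sub>1 = y - x\<close> is orthogonal to 1 and has squared norm \<open>t - s\<close>. Writing
  \<open>f(y) = f(x) + f'(x) (y - x) + (y - x)\<^sup>2 g(y)\<close>, where \<open>g\<close> is the continuous function equal to
  the \<open>x\<close>-derivative of \<open>(f(y) - f(x)) / (y - x)\<close> for \<open>y \<noteq> x\<close> and to \<open>f''(x) / 2\<close> for \<open>y = x\<close>, the
  difference quotient becomes the integral of \<open>g\<close> against the probability measure
  \<open>(y - x)\<^sup>2 P\<^sub>s\<^sub>,\<^sub>t(x, dy) / (t - s)\<close>. This bounds the quotient by \<open>sup |f''| / 2\<close> for all times, and leaves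
  the claim that these probability measures converge to \<open>\<nu>\<^sub>x\<^sub>,\<^sub>t\<close> as \<open>s\<close> and \<open>t\<close> approach each other.

  Their moments are read off the Jacobi matrix \<open>J\<close> of the polynomials \<open>Q\<^sub>n\<close>: the integral of
  \<open>(y - x)\<^sup>2 p(y)\<close> is the pairing of \<open>p Q\<^sub>1\<close> with \<open>Q\<^sub>1\<close>, hence \<open>t - s\<close> times the coefficient of \<open>Q\<^sub>1\<close> in the
  expansion of \<open>p Q\<^sub>1\<close> (\<open>integral_square_times_poly\<close>). These coefficients are polynomials in the entries of \<open>J\<close>,
  so they are continuous in \<open>s\<close> and \<open>t\<close>. At \<open>s = t\<close> the first off-diagonal entry vanishes, the multiples of
  \<open>y - x\<close> become an invariant subspace, and the remaining entries are exactly those in the recursion of the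
  polynomials \<open>W\<^sub>n\<close> (\<open>jacobi_coord_shift\<close>, \<open>W_poly_eq_jacobi_poly\<close>). So the moments converge to those of \<open>\<nu>\<^sub>x\<^sub>,\<^sub>t\<close>. All
  measures live on a common compact interval, since the Jacobi coefficients are uniformly bounded, and
  polynomial approximation of \<open>g\<close> on that interval finishes the argument
  (\<open>increment_quotient_tendsto\<close>). Compactness of the support also lets the same limit apply to polynomials \<open>f\<close>.

  The orthogonality measures themselves come from Favard's theorem for bounded positive coefficients: Gauss
  quadrature at the roots of the polynomials gives finitely supported measures with the right first
  moments, a weak limit has all of them (\<open>jacobi_measure_ex\<close>), and the growth of the moments forces
  compact support and uniqueness (\<open>jacobi_measure_unique\<close>).
\<close>

section \<open>Jacobi matrices and their moment functional\<close>

text \<open>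
  Monic orthogonal polynomials with Jacobi coefficients \<open>b\<close> (diagonal) and \<open>l\<close> (products of
  off-diagonal entries): \<open>y P\<^sub>n = P\<^sub>n\<^sub>+\<^sub>1 + b\<^sub>n P\<^sub>n + l\<^sub>n\<^sub>-\<^sub>1 P\<^sub>n\<^sub>-\<^sub>1\<close>. The indexing of \<open>l\<close> starts at 0
  with the coefficient of \<open>P\<^sub>0\<close> in \<open>y P\<^sub>1\<close>.
\<close>

fun jacobi_poly :: "(nat \<Rightarrow> real) \<Rightarrow> (nat \<Rightarrow> real) \<Rightarrow> nat \<Rightarrow> real poly" where
  "jacobi_poly b l 0 = 1"
| "jacobi_poly b l (Suc 0) = [:- b 0, 1:]"
| "jacobi_poly b l (Suc (Suc n)) = [:- b (Suc n), 1:] * jacobi_poly b l (Suc n) - smult (l n) (jacobi_poly b l n)"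

text \<open>
  The matrix of multiplication by \<open>y\<close> in the basis \<open>P\<^sub>0, P\<^sub>1, \<dots>\<close>, acting on coordinate sequences.
\<close>

definition jacobi_op :: "(nat \<Rightarrow> real) \<Rightarrow> (nat \<Rightarrow> real) \<Rightarrow> (nat \<Rightarrow> real) \<Rightarrow> nat \<Rightarrow> real" where
  "jacobi_op b l v j = (case j of 0 \<Rightarrow> 0 | Suc i \<Rightarrow> v i) + b j * v j + l j * v (Suc j)"

text \<open>
  The coordinates of a polynomial in the basis \<open>P\<^sub>0, P\<^sub>1, \<dots>\<close>, computed by Horner's scheme. Coordinate
  0 is the linear functional that sends \<open>P\<^sub>0\<close> to 1 and all other \<open>P\<^sub>n\<close> to 0; it plays the role of the
  integral against the orthogonality measure before that measure is known to exist.
\<close>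

definition jacobi_coord :: "(nat \<Rightarrow> real) \<Rightarrow> (nat \<Rightarrow> real) \<Rightarrow> real poly \<Rightarrow> nat \<Rightarrow> real" where
  "jacobi_coord b l p = fold_coeffs (\<lambda>a v j. (if j = 0 then a else 0) + jacobi_op b l v j) p (\<lambda>_. 0)"

text \<open>
  The squared norm of \<open>P\<^sub>n\<close> with respect to the functional above.
\<close>

definition jacobi_weight :: "(nat \<Rightarrow> real) \<Rightarrow> nat \<Rightarrow> real" where
  "jacobi_weight l n = (\<Prod>i<n. l i)"

lemma jacobi_op_zero [simp]: "jacobi_op b l (\<lambda>_. 0) = (\<lambda>_. 0)"
  by (auto simp: jacobi_op_def split: nat.split)

lemma jacobi_op_add: "jacobi_op b l (\<lambda>j. u j + v j) j = jacobi_op b l u j + jacobi_op b l v j"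
  by (auto simp: jacobi_op_def algebra_simps split: nat.split)

lemma jacobi_op_scale: "jacobi_op b l (\<lambda>j. c * v j) j = c * jacobi_op b l v j"
  by (auto simp: jacobi_op_def algebra_simps split: nat.split)

lemma jacobi_coord_0 [simp]: "jacobi_coord b l 0 = (\<lambda>_. 0)"
  by (simp add: jacobi_coord_def)

lemma jacobi_coord_pCons:
  "jacobi_coord b l (pCons a p) = (\<lambda>j. (if j = 0 then a else 0) + jacobi_op b l (jacobi_coord b l p) j)"
proof (cases "a = 0 \<and> p = 0")
  case False
  then show ?thesis
    by (cases "p = 0") (auto simp: jacobi_coord_def fun_eq_iff)
qed auto

lemma jacobi_coord_add: "jacobi_coord b l (p + q) = (\<lambda>j. jacobi_coord b l p j + jacobi_coord b l q j)"
  by (induction p q rule: poly_induct2) (simp, simp add: jacobi_coord_pCons jacobi_op_add, auto simp: fun_eq_iff)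

lemma jacobi_coord_smult: "jacobi_coord b l (smult c p) = (\<lambda>j. c * jacobi_coord b l p j)"
  by (induction p) (simp, simp add: jacobi_coord_pCons jacobi_op_scale, auto simp: fun_eq_iff algebra_simps)

lemma jacobi_coord_minus: "jacobi_coord b l (p - q) = (\<lambda>j. jacobi_coord b l p j - jacobi_coord b l q j)"
proof -
  have "p - q = p + smult (-1) q" by simp
  then show ?thesis by (simp only: jacobi_coord_add jacobi_coord_smult) auto
qed

lemma jacobi_coord_sum: "jacobi_coord b l (\<Sum>i\<in>A. f i) j = (\<Sum>i\<in>A. jacobi_coord b l (f i) j)"
  by (induction A rule: infinite_finite_induct) (auto simp: jacobi_coord_add)

lemma linear_factor_mult: "[:- c, 1:] * p = pCons 0 p - smult c p" for c :: real
  by simp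

lemma jacobi_coord_linear_mult:
  "jacobi_coord b l ([:- c, 1:] * p) = (\<lambda>j. jacobi_op b l (jacobi_coord b l p) j - c * jacobi_coord b l p j)"
  unfolding linear_factor_mult by (simp add: jacobi_coord_minus jacobi_coord_pCons jacobi_coord_smult)

lemma jacobi_coord_jacobi_poly: "jacobi_coord b l (jacobi_poly b l n) = (\<lambda>j. if j = n then 1 else 0)"
proof (induction b l n rule: jacobi_poly.induct)
  case (1 b l)
  show ?case by (simp add: one_pCons jacobi_coord_pCons)
next
  case (2 b l)
  show ?case by (auto simp: jacobi_coord_pCons fun_eq_iff jacobi_op_def split: nat.split)
next
  case (3 b l n)
  show ?case
    by (subst jacobi_poly.simps, subst jacobi_coord_minus, subst jacobi_coord_linear_mult)
       (auto simp: 3 jacobi_coord_smult fun_eq_iff jacobi_op_def split: nat.split)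
qed

lemma degree_lead_coeff_jacobi_poly: "degree (jacobi_poly b l n) = n \<and> lead_coeff (jacobi_poly b l n) = 1"
proof (induction b l n rule: jacobi_poly.induct)
  case (3 b l n)
  let ?p = "[:- b (Suc n), 1:] * jacobi_poly b l (Suc n)" and ?q = "- smult (l n) (jacobi_poly b l n)"
  have nz: "jacobi_poly b l (Suc n) \<noteq> 0" using 3 by auto
  have dp: "degree ?p = Suc (Suc n)"
    using 3 nz by (subst degree_mult_eq) auto
  have "degree ?q < degree ?p"
    using 3 dp by (simp add: degree_smult_eq)
  have "coeff ?p (Suc (Suc n)) = 1"
    unfolding dp[symmetric] lead_coeff_mult using 3 by auto
  moreover have "coeff ?q (Suc (Suc n)) = 0"
    using \<open>degree ?q < degree ?p\<close> dp by (intro coeff_eq_0) simp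
  moreover have "jacobi_poly b l (Suc (Suc n)) = ?p + ?q"
    by (simp only: jacobi_poly.simps diff_conv_add_uminus)
  moreover have "degree (?p + ?q) = Suc (Suc n)"
    using degree_add_eq_left[OF \<open>degree ?q < degree ?p\<close>] dp by simp
  ultimately show ?case by (simp only: coeff_add) simp
qed auto

lemma degree_jacobi_poly [simp]: "degree (jacobi_poly b l n) = n"
  and lead_coeff_jacobi_poly [simp]: "coeff (jacobi_poly b l n) n = 1"
  using degree_lead_coeff_jacobi_poly[of b l n] by auto

lemma jacobi_poly_nonzero [simp]: "jacobi_poly b l n \<noteq> 0"
  using lead_coeff_jacobi_poly[of b l n] by (metis coeff_0 zero_neq_one)

lemma jacobi_poly_basis_ex:
  "degree p \<le> N \<Longrightarrow> \<exists>c. p = (\<Sum>n\<le>N. smult (c n) (jacobi_poly b l n))"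
proof (induction N arbitrary: p)
  case 0
  then obtain a where "p = [:a:]" by (auto elim: degree_eq_zeroE)
  then show ?case by (auto intro!: exI[of _ "\<lambda>_. a"])
next
  case (Suc N)
  define r where "r = p - smult (coeff p (Suc N)) (jacobi_poly b l (Suc N))"
  have "degree r \<le> N"
  proof (rule degree_le, intro allI impI)
    fix i assume "N < i"
    show "coeff r i = 0"
    proof (cases "i = Suc N")
      case True then show ?thesis unfolding r_def coeff_diff coeff_smult by simp
    next
      case False
      with \<open>N < i\<close> have "i > Suc N" by simp
      then show ?thesis unfolding r_def using Suc.prems
        by (simp add: coeff_eq_0 del: jacobi_poly.simps)
    qed
  qed
  from Suc.IH[OF this] obtain c where c: "r = (\<Sum>n\<le>N. smult (c n) (jacobi_poly b l n))" by blast
  have "p = (\<Sum>n\<le>Suc N. smult ((c(Suc N := coeff p (Suc N))) n) (jacobi_poly b l n))"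
    using c unfolding r_def by (simp add: algebra_simps del: jacobi_poly.simps)
  then show ?case by blast
qed

lemma jacobi_poly_expansion:
  assumes "degree p \<le> N"
  shows "p = (\<Sum>n\<le>N. smult (jacobi_coord b l p n) (jacobi_poly b l n))"
proof -
  obtain c where c: "p = (\<Sum>n\<le>N. smult (c n) (jacobi_poly b l n))"
    using jacobi_poly_basis_ex[OF assms] by blast
  have "jacobi_coord b l p j = c j" if "j \<le> N" for j
    using that unfolding c by (simp add: jacobi_coord_sum jacobi_coord_smult jacobi_coord_jacobi_poly if_distrib cong: if_cong)
  then have "(\<Sum>n\<le>N. smult (jacobi_coord b l p n) (jacobi_poly b l n)) = (\<Sum>n\<le>N. smult (c n) (jacobi_poly b l n))"
    by (intro sum.cong) auto
  with c show ?thesis by simp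
qed

text \<open>
  Orthogonality: pairing with \<open>P\<^sub>n\<close> reads off the \<open>n\<close>-th coordinate. The recursion for \<open>P\<^sub>n\<close> cancels
  all but one term of the multiplication matrix, because that matrix is symmetric with respect to
  the weights.
\<close>

lemma jacobi_coord_mult_jacobi_poly:
  "jacobi_coord b l (p * jacobi_poly b l n) 0 = jacobi_weight l n * jacobi_coord b l p n"
proof (induction n arbitrary: p rule: less_induct)
  case (less n)
  show ?case
  proof (cases n)
    case 0 then show ?thesis by (simp add: jacobi_weight_def)
  next
    case (Suc m)
    show ?thesis
    proof (cases m)
      case 0
      have "p * jacobi_poly b l n = [:- b 0, 1:] * p" using Suc 0 by (simp add: mult.commute)
      then show ?thesis using Suc 0
        unfolding jacobi_coord_linear_mult by (simp only: jacobi_coord_linear_mult) (simp add: jacobi_op_def jacobi_weight_def)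
    next
      case [simp]: (Suc k)
      note [simp] = \<open>n = Suc m\<close>
      have "p * jacobi_poly b l n = ([:- b (Suc k), 1:] * p) * jacobi_poly b l (Suc k) - smult (l k) (p * jacobi_poly b l k)"
        by (simp add: algebra_simps)
      then have "jacobi_coord b l (p * jacobi_poly b l n) 0 =
         jacobi_weight l (Suc k) * (jacobi_op b l (jacobi_coord b l p) (Suc k) - b (Suc k) * jacobi_coord b l p (Suc k))
         - l k * (jacobi_weight l k * jacobi_coord b l p k)"
        by (simp only: jacobi_coord_minus jacobi_coord_smult)
           (simp add: less.IH jacobi_coord_linear_mult del: mult_pCons_left jacobi_poly.simps)
      also have "\<dots> = jacobi_weight l n * jacobi_coord b l p n"
        by (simp add: jacobi_op_def jacobi_weight_def algebra_simps)
      finally show ?thesis .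
    qed
  qed
qed

lemma jacobi_coord_square_pos:
  assumes "\<And>n. l n > 0" and "p \<noteq> 0"
  shows "jacobi_coord b l (p * p) 0 > 0"
proof -
  let ?N = "degree p"
  have w: "jacobi_weight l n > 0" for n unfolding jacobi_weight_def using assms(1) by (auto intro: prod_pos)
  have "p * p = p * (\<Sum>n\<le>?N. smult (jacobi_coord b l p n) (jacobi_poly b l n))"
    using jacobi_poly_expansion[of p ?N b l] by simp
  also have "\<dots> = (\<Sum>n\<le>?N. smult (jacobi_coord b l p n) (p * jacobi_poly b l n))"
    by (simp add: sum_distrib_left)
  finally have "p * p = (\<Sum>n\<le>?N. smult (jacobi_coord b l p n) (p * jacobi_poly b l n))" .
  then have eq: "jacobi_coord b l (p * p) 0 = (\<Sum>n\<le>?N. jacobi_weight l n * (jacobi_coord b l p n)\<^sup>2)"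
    by (simp add: jacobi_coord_sum jacobi_coord_smult jacobi_coord_mult_jacobi_poly power2_eq_square algebra_simps)
  have "\<exists>n\<le>?N. jacobi_coord b l p n \<noteq> 0"
  proof (rule ccontr)
    assume "\<not> ?thesis"
    then have "p = 0" using jacobi_poly_expansion[of p ?N b l] by simp
    with assms(2) show False by simp
  qed
  then obtain n where n: "n \<le> ?N" "jacobi_coord b l p n \<noteq> 0" by blast
  have "0 < jacobi_weight l n * (jacobi_coord b l p n)\<^sup>2" using n w by simp
  also have "\<dots> \<le> (\<Sum>n\<le>?N. jacobi_weight l n * (jacobi_coord b l p n)\<^sup>2)"
    using n w by (intro member_le_sum) (auto simp: less_imp_le)
  finally show ?thesis using eq by simp
qed

lemma jacobi_coord_mult_low_degree:
  assumes "degree p < n"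
  shows "jacobi_coord b l (p * jacobi_poly b l n) 0 = 0"
proof -
  have "jacobi_coord b l p n = 0"
  proof -
    have "p = (\<Sum>i\<le>n - 1. smult (jacobi_coord b l p i) (jacobi_poly b l i))"
      using assms by (intro jacobi_poly_expansion) simp
    then have "jacobi_coord b l p n = jacobi_coord b l (\<Sum>i\<le>n - 1. smult (jacobi_coord b l p i) (jacobi_poly b l i)) n"
      by (rule arg_cong)
    also have "\<dots> = (\<Sum>i\<le>n - 1. jacobi_coord b l p i * jacobi_coord b l (jacobi_poly b l i) n)"
      by (simp only: jacobi_coord_sum jacobi_coord_smult)
    also have "\<dots> = 0"
      using assms by (intro sum.neutral) (auto simp: jacobi_coord_jacobi_poly)
    finally show ?thesis .
  qed
  then show ?thesis by (simp add: jacobi_coord_mult_jacobi_poly)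
qed

subsection \<open>Bounds on moments and roots\<close>

lemma abs_jacobi_op_le:
  assumes "\<And>n. \<bar>b n\<bar> \<le> B" "\<And>n. 0 < l n \<and> l n \<le> C" "\<And>j. \<bar>v j\<bar> \<le> K"
  shows "\<bar>jacobi_op b l v j\<bar> \<le> (1 + B + C) * K"
proof -
  have K: "K \<ge> 0" using assms(3)[of 0] by simp
  have "\<bar>case j of 0 \<Rightarrow> 0 | Suc i \<Rightarrow> v i\<bar> \<le> K" using assms(3) K by (auto split: nat.split)
  moreover have "\<bar>b j * v j\<bar> \<le> B * K" unfolding abs_mult
    using assms(1)[of j] assms(3)[of j] by (intro mult_mono) auto
  moreover have "\<bar>l j * v (Suc j)\<bar> \<le> C * K" unfolding abs_mult
    using assms(2)[of j] assms(3)[of "Suc j"] by (intro mult_mono) auto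
  ultimately show ?thesis unfolding jacobi_op_def by (simp add: algebra_simps)
qed

lemma abs_moment_le:
  assumes "\<And>n. \<bar>b n\<bar> \<le> B" "\<And>n. 0 < l n \<and> l n \<le> C"
  shows "\<bar>jacobi_coord b l (monom 1 k) j\<bar> \<le> (1 + B + C) ^ k"
proof (induction k arbitrary: j)
  case 0 then show ?case by (simp add: monom_0 jacobi_coord_pCons)
next
  case (Suc k)
  have "jacobi_coord b l (monom 1 (Suc k)) = jacobi_op b l (jacobi_coord b l (monom 1 k))"
    by (auto simp: monom_Suc jacobi_coord_pCons fun_eq_iff)
  then show ?case using abs_jacobi_op_le[OF assms Suc.IH] by simp
qed

text \<open>
  Outside the interval of radius \<open>1 + B + C\<close> the sequence \<open>|P\<^sub>n(x)|\<close> does not decrease with \<open>n\<close>, so no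
  \<open>P\<^sub>n\<close> has a root there.
\<close>

lemma jacobi_poly_growth:
  assumes "\<And>n. \<bar>b n\<bar> \<le> B" "\<And>n. 0 < l n \<and> l n \<le> C" "\<bar>x\<bar> > 1 + B + C"
  shows "\<bar>poly (jacobi_poly b l n) x\<bar> > 0 \<and> \<bar>poly (jacobi_poly b l n) x\<bar> \<le> \<bar>poly (jacobi_poly b l (Suc n)) x\<bar>"
proof (induction n)
  case 0
  have "C > 0" using assms(2)[of 0] by linarith
  then show ?case using assms(3) assms(1)[of 0] by simp
next
  case (Suc n)
  let ?u = "poly (jacobi_poly b l n) x" and ?v = "poly (jacobi_poly b l (Suc n)) x"
  have "1 + C \<le> \<bar>x - b (Suc n)\<bar>" using assms(3) assms(1)[of "Suc n"] by linarith
  then have 1: "(1 + C) * \<bar>?v\<bar> \<le> \<bar>x - b (Suc n)\<bar> * \<bar>?v\<bar>" by (rule mult_right_mono) simp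
  have 2: "\<bar>l n * ?u\<bar> \<le> C * \<bar>?v\<bar>" unfolding abs_mult
    using assms(2)[of n] Suc by (intro mult_mono) auto
  have "poly (jacobi_poly b l (Suc (Suc n))) x = (x - b (Suc n)) * ?v - l n * ?u"
    by (simp add: algebra_simps)
  then have "\<bar>?v\<bar> \<le> \<bar>poly (jacobi_poly b l (Suc (Suc n))) x\<bar>"
    using 1 2 abs_triangle_ineq2[of "(x - b (Suc n)) * ?v" "l n * ?u"] unfolding abs_mult[symmetric]
    by (simp only:) (simp add: algebra_simps del: jacobi_poly.simps)
  then show ?case using Suc by (auto simp del: jacobi_poly.simps)
qed

lemma jacobi_poly_root_bound:
  assumes "\<And>n. \<bar>b n\<bar> \<le> B" "\<And>n. 0 < l n \<and> l n \<le> C" "poly (jacobi_poly b l n) x = 0"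
  shows "\<bar>x\<bar> \<le> 1 + B + C"
  using jacobi_poly_growth[of b B l C x n] assms by (cases "\<bar>x\<bar> > 1 + B + C") auto

subsection \<open>All roots are real and simple\<close>

text \<open>
  If \<open>((y - a)\<^sup>2 + c) g = P\<^sub>n\<close> with \<open>c \<ge> 0\<close>, then \<open>g\<close> has degree below \<open>n\<close>, so the functional
  vanishes on \<open>g P\<^sub>n\<close>; but \<open>g P\<^sub>n = ((y - a) g)\<^sup>2 + c g\<^sup>2\<close>. Taking \<open>c = 0\<close> excludes double roots, and
  \<open>c > 0\<close> excludes pairs of conjugate non-real roots.
\<close>

lemma jacobi_poly_no_square_factor:
  assumes l: "\<And>n. l n > 0" and c: "c \<ge> 0"
  shows "\<not> [:a\<^sup>2 + c, - 2 * a, 1:] dvd jacobi_poly b l n"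
proof
  assume "[:a\<^sup>2 + c, - 2 * a, 1:] dvd jacobi_poly b l n"
  then obtain g where g: "jacobi_poly b l n = [:a\<^sup>2 + c, - 2 * a, 1:] * g" by (elim dvdE)
  then have g0: "g \<noteq> 0" using jacobi_poly_nonzero by force
  have "n = 2 + degree g" using g0 g degree_jacobi_poly[of b l n] by (simp add: degree_mult_eq del: mult_pCons_left)
  then have z: "jacobi_coord b l (g * jacobi_poly b l n) 0 = 0" by (intro jacobi_coord_mult_low_degree) simp
  have "[:a\<^sup>2 + c, - 2 * a, 1:] = [:-a,1:] * [:-a,1:] + [:c:]"
    by (simp add: power2_eq_square)
  moreover have "g * ([:c:] * g) = smult c (g * g)" by simp
  ultimately have "g * jacobi_poly b l n = ([:-a,1:] * g) * ([:-a,1:] * g) + smult c (g * g)"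
    unfolding g by (simp only: distrib_left distrib_right ac_simps)
  moreover have "jacobi_coord b l (([:-a,1:] * g) * ([:-a,1:] * g)) 0 > 0"
    by (intro jacobi_coord_square_pos l) (use g0 in \<open>simp del: mult_pCons_left\<close>)
  moreover have "jacobi_coord b l (g * g) 0 > 0" by (intro jacobi_coord_square_pos l g0)
  moreover have "c * jacobi_coord b l (g * g) 0 \<ge> 0" using c calculation by simp
  ultimately show False using z by (simp add: jacobi_coord_add jacobi_coord_smult del: mult_pCons_left)
qed

lemma prod_roots_dvd:
  fixes P :: "'a::idom poly"
  assumes "finite X" "\<And>a. a \<in> X \<Longrightarrow> poly P a = 0"
  shows "(\<Prod>a\<in>X. [:- a, 1:]) dvd P"
  using assms
proof (induction X)
  case (insert a X)
  then obtain g where g: "P = (\<Prod>a\<in>X. [:- a, 1:]) * g" by (auto elim: dvdE)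
  have "poly (\<Prod>a\<in>X. [:- a, 1:]) a \<noteq> 0"
    using insert by (auto simp: poly_prod)
  then have "poly g a = 0" using insert.prems[of a] g by simp
  then have "[:-a, 1:] dvd g" by (simp add: poly_eq_0_iff_dvd)
  then have "[:-a, 1:] * (\<Prod>a\<in>X. [:- a, 1:]) dvd P"
    unfolding g by (subst mult.commute) (rule mult_dvd_mono, simp_all)
  then show ?case using insert by simp
qed simp

lemma poly_map_of_real_add:
  "poly (map_poly complex_of_real (p + q)) z = poly (map_poly of_real p) z + poly (map_poly of_real q) z"
  by (induction p q rule: poly_induct2) (simp, simp add: map_poly_pCons distrib_left)

lemma poly_map_of_real_smult:
  "poly (map_poly complex_of_real (smult c p)) z = of_real c * poly (map_poly of_real p) z"
  by (induction p) (simp, simp add: map_poly_pCons distrib_left mult.left_commute)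

lemma poly_map_of_real_mult:
  "poly (map_poly complex_of_real (p * q)) z = poly (map_poly of_real p) z * poly (map_poly of_real q) z"
proof (induction p)
  case (pCons a p)
  have "poly (map_poly complex_of_real (pCons a p * q)) z
      = of_real a * poly (map_poly of_real q) z + z * poly (map_poly of_real (p * q)) z"
    by (simp add: poly_map_of_real_add poly_map_of_real_smult map_poly_pCons)
  then show ?case using pCons.IH by (simp add: map_poly_pCons distrib_right mult.assoc)
qed simp

lemma card_roots_jacobi_poly:
  assumes l: "\<And>n. l n > 0"
  shows "card {x. poly (jacobi_poly b l n) x = 0} = n"
proof -
  define P where "P = jacobi_poly b l n"
  define X where "X = {x. poly P x = 0}"
  have P0: "P \<noteq> 0" by (simp add: P_def)
  have fin: "finite X" unfolding X_def using P0 by (rule poly_roots_finite)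
  define r where "r = (\<Prod>a\<in>X. [:- a, 1:])"
  have "r dvd P" unfolding r_def using fin by (rule prod_roots_dvd) (simp add: X_def)
  then obtain g where g: "P = r * g" by (elim dvdE)
  have deg_r: "degree r = card X" unfolding r_def by (subst degree_prod_eq_sum_degree) auto
  have rg0: "r \<noteq> 0" "g \<noteq> 0" using g P0 by auto
  have "degree g = 0"
  proof (rule ccontr)
    assume "degree g \<noteq> 0"
    define G where "G = map_poly complex_of_real g"
    have "degree G \<noteq> 0" unfolding G_def using \<open>degree g \<noteq> 0\<close> by (simp add: degree_map_poly)
    then have "\<not> constant (poly G)" by (simp add: constant_degree)
    from fundamental_theorem_of_algebra[OF this] obtain z where z: "poly G z = 0" by blast
    define a where "a = Re z"
    define c where "c = (Im z)\<^sup>2"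
    \<comment> \<open>the real quadratic with roots \<open>z\<close> and its conjugate; it is \<open>(y - z)\<^sup>2\<close> if \<open>z\<close> is real\<close>
    define Q where "Q = [:a\<^sup>2 + c, - 2 * a, 1:]"
    have Qz: "poly (map_poly complex_of_real Q) z = 0"
      by (auto simp: Q_def a_def c_def complex_eq_iff map_poly_pCons power2_eq_square algebra_simps)
    have "Q dvd P"
    proof (cases "Im z = 0")
      case True
      then have zr: "z = of_real a" by (simp add: a_def complex_eq_iff)
      have "complex_of_real (poly g a) = poly G z" unfolding G_def zr by (induction g) (auto simp: map_poly_pCons)
      then have ga: "poly g a = 0" using z by simp
      then have "a \<in> X" by (simp add: X_def g)
      then have "[:-a,1:] dvd r" unfolding r_def using fin by (intro dvd_prodI)
      moreover have "[:-a,1:] dvd g" using ga by (simp add: poly_eq_0_iff_dvd)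
      ultimately have "[:-a,1:] * [:-a,1:] dvd P" unfolding g by (rule mult_dvd_mono)
      moreover have "[:-a,1:] * [:-a,1:] = Q" using True by (simp add: Q_def c_def power2_eq_square)
      ultimately show ?thesis by simp
    next
      case False
      \<comment> \<open>a real polynomial of degree at most 1 with a non-real root is 0\<close>
      define s where "s = g mod Q"
      have Q0: "Q \<noteq> 0" and dQ: "degree Q = 2" by (simp_all add: Q_def)
      have "g = g div Q * Q + s" by (simp add: s_def)
      then have "poly G z = poly (map_poly of_real (g div Q)) z * poly (map_poly of_real Q) z
          + poly (map_poly of_real s) z"
        unfolding G_def by (metis poly_map_of_real_add poly_map_of_real_mult)
      then have sz: "poly (map_poly complex_of_real s) z = 0" using z Qz by simp
      have "degree s < 2" using degree_mod_less[OF Q0, of g] dQ by (auto simp: s_def)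
      then have "s = [:coeff s 0, coeff s 1:]"
        by (intro poly_eqI) (auto simp: coeff_pCons coeff_eq_0 split: nat.split)
      then obtain u v where s: "s = [:u, v:]" by blast
      have "v * Im z = 0" "u + v * Re z = 0" using sz by (auto simp: s complex_eq_iff map_poly_pCons algebra_simps)
      then have "s = 0" using False s by simp
      then have "Q dvd g" unfolding s_def by (simp add: dvd_eq_mod_eq_0)
      then show ?thesis using g by simp
    qed
    then show False using jacobi_poly_no_square_factor[of l c a b n] l by (simp add: Q_def P_def c_def)
  qed
  then have "degree P = degree r" using g rg0 by (simp add: degree_mult_eq)
  then show ?thesis using deg_r by (simp add: P_def X_def)
qed

section \<open>Orthogonality measures for bounded Jacobi coefficients\<close>

text \<open>
  Jacobi coefficients with \<open>|b\<^sub>n| \<le> B\<close> and \<open>0 < l\<^sub>n \<le> C\<close>.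
\<close>

definition jacobi_bounded :: "(nat \<Rightarrow> real) \<Rightarrow> (nat \<Rightarrow> real) \<Rightarrow> real \<Rightarrow> real \<Rightarrow> bool" where
  "jacobi_bounded b l B C \<longleftrightarrow> (\<forall>n. \<bar>b n\<bar> \<le> B) \<and> (\<forall>n. 0 < l n \<and> l n \<le> C)"

lemma jacobi_boundedD:
  assumes "jacobi_bounded b l B C"
  shows "\<bar>b n\<bar> \<le> B" "0 < l n" "l n \<le> C" "0 \<le> B" "0 < C"
proof -
  show *: "\<bar>b n\<bar> \<le> B" "0 < l n" "l n \<le> C" for n using assms by (auto simp: jacobi_bounded_def)
  show "0 \<le> B" using *(1)[of 0] by linarith
  show "0 < C" using *(2,3)[of 0] by linarith
qed

text \<open>
  A probability measure that integrates polynomials as the functional of the coefficients \<open>b\<close>, \<open>l\<close>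
  does; equivalently, one for which the polynomials \<open>P\<^sub>n\<close> are orthogonal.
\<close>

definition jacobi_measure :: "(nat \<Rightarrow> real) \<Rightarrow> (nat \<Rightarrow> real) \<Rightarrow> real measure \<Rightarrow> bool" where
  "jacobi_measure b l \<mu> \<longleftrightarrow> prob_space \<mu> \<and> sets \<mu> = sets borel \<and>
     (\<forall>p. integrable \<mu> (poly p) \<and> (LINT y|\<mu>. poly p y) = jacobi_coord b l p 0)"

lemma jacobi_measureD:
  assumes "jacobi_measure b l \<mu>"
  shows "prob_space \<mu>" "sets \<mu> = sets borel" "space \<mu> = UNIV"
    "integrable \<mu> (poly p)" "(LINT y|\<mu>. poly p y) = jacobi_coord b l p 0" "real_distribution \<mu>"
proof -
  show 1: "prob_space \<mu>" "sets \<mu> = sets borel" "integrable \<mu> (poly p)"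
    "(LINT y|\<mu>. poly p y) = jacobi_coord b l p 0"
    using assms by (auto simp: jacobi_measure_def)
  show "space \<mu> = UNIV" using sets_eq_imp_space_eq[OF 1(2)] by simp
  show "real_distribution \<mu>" using 1
    by (simp add: real_distribution_def real_distribution_axioms_def)
qed

lemma orthogonality_measure_iff_jacobi_measure:
  "orthogonality_measure (jacobi_poly b l) \<mu> \<longleftrightarrow> jacobi_measure b l \<mu>"
proof
  assume L: "orthogonality_measure (jacobi_poly b l) \<mu>"
  then interpret prob_space \<mu> by (simp add: orthogonality_measure_def)
  have int: "integrable \<mu> (poly (jacobi_poly b l n))"
    and val: "(LINT y|\<mu>. poly (jacobi_poly b l n) y) = (if n = 0 then 1 else 0)" for n
  proof -
    have "integrable \<mu> (\<lambda>y. poly (jacobi_poly b l n) y * poly (jacobi_poly b l 0) y)"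
      using L unfolding orthogonality_measure_def by blast
    then show "integrable \<mu> (poly (jacobi_poly b l n))" by simp
    have "n \<noteq> 0 \<Longrightarrow> (LINT y|\<mu>. poly (jacobi_poly b l n) y * poly (jacobi_poly b l 0) y) = 0"
      using L unfolding orthogonality_measure_def by blast
    then show "(LINT y|\<mu>. poly (jacobi_poly b l n) y) = (if n = 0 then 1 else 0)"
      by (auto simp: prob_space)
  qed
  have "integrable \<mu> (poly p) \<and> (LINT y|\<mu>. poly p y) = jacobi_coord b l p 0" for p
  proof -
    have p: "poly p = (\<lambda>y. \<Sum>n\<le>degree p. jacobi_coord b l p n * poly (jacobi_poly b l n) y)"
      by (subst jacobi_poly_expansion[of p "degree p" b l, OF order_refl]) (auto simp: poly_sum)
    show ?thesis unfolding p using int by (simp add: val if_distrib cong: if_cong)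
  qed
  then show "jacobi_measure b l \<mu>" using L by (auto simp: jacobi_measure_def orthogonality_measure_def)
next
  assume R: "jacobi_measure b l \<mu>"
  have "(LINT y|\<mu>. poly (jacobi_poly b l m) y * poly (jacobi_poly b l n) y) = 0" if "m \<noteq> n" for m n
    using jacobi_measureD(5)[OF R, of "jacobi_poly b l m * jacobi_poly b l n"] that
    by (simp add: jacobi_coord_mult_jacobi_poly jacobi_coord_jacobi_poly)
  moreover have "integrable \<mu> (\<lambda>y. poly (jacobi_poly b l m) y * poly (jacobi_poly b l n) y)" for m n
  proof -
    have "poly (jacobi_poly b l m * jacobi_poly b l n) = (\<lambda>y. poly (jacobi_poly b l m) y * poly (jacobi_poly b l n) y)"
      by auto
    then show ?thesis using jacobi_measureD(4)[OF R, of "jacobi_poly b l m * jacobi_poly b l n"] by simp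
  qed
  ultimately show "orthogonality_measure (jacobi_poly b l) \<mu>"
    using R by (auto simp: jacobi_measure_def orthogonality_measure_def)
qed

subsection \<open>Gauss quadrature\<close>

text \<open>
  The functional agrees on degrees below \<open>2 N\<close> with a nonnegative combination of evaluations at the
  \<open>N\<close> roots of \<open>P\<^sub>N\<close>. The weight at a root is the value of the functional on the Lagrange polynomial of
  that root, and equals its value on the square of that polynomial.
\<close>

lemma gauss_quadrature:
  fixes b l :: "nat \<Rightarrow> real"
  assumes l: "\<And>n. l n > 0" and N: "N > 0"
  defines "X \<equiv> {x. poly (jacobi_poly b l N) x = 0}"
  shows "\<exists>w. (\<forall>x\<in>X. w x \<ge> 0) \<and>
     (\<forall>p. degree p < 2 * N \<longrightarrow> jacobi_coord b l p 0 = (\<Sum>x\<in>X. w x * poly p x))"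
proof -
  let ?P = "jacobi_poly b l N"
  have fin: "finite X" unfolding X_def by (rule poly_roots_finite) simp
  have card: "card X = N" unfolding X_def using card_roots_jacobi_poly[of l b N] l by simp
  define ell where "ell x = smult (1 / (\<Prod>a\<in>X - {x}. x - a)) (\<Prod>a\<in>X - {x}. [:- a, 1:])" for x
  have ell: "poly (ell x) y = (if y = x then 1 else 0)" if "x \<in> X" "y \<in> X" for x y
    using that fin by (auto simp: ell_def poly_prod)
  have deg_ell: "degree (ell x) < N" if "x \<in> X" for x
  proof -
    have "degree (\<Prod>a\<in>X - {x}. [:- a, 1:]) = card (X - {x})"
      by (subst degree_prod_eq_sum_degree) auto
    then have "degree (ell x) \<le> card (X - {x})"
      unfolding ell_def by (metis degree_smult_le)
    then show ?thesis using that fin card N by simp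
  qed
  define w where "w x = jacobi_coord b l (ell x) 0" for x
  have quad: "jacobi_coord b l p 0 = (\<Sum>x\<in>X. w x * poly p x)" if p: "degree p < 2 * N" for p
  proof -
    define q r where "q = p div ?P" and "r = p mod ?P"
    have pqr: "p = q * ?P + r" by (simp add: q_def r_def)
    have dr: "degree r < N"
      using degree_mod_less[of ?P p] N by (auto simp: r_def)
    have dq: "degree q < N"
    proof (rule ccontr)
      assume "\<not> degree q < N"
      then have "q \<noteq> 0" using N by auto
      then have "degree (q * ?P) = degree q + N" by (simp add: degree_mult_eq)
      with dr have "degree p = degree q + N" unfolding pqr by (subst degree_add_eq_left) auto
      with p \<open>\<not> degree q < N\<close> show False by simp
    qed
    have r: "r = (\<Sum>x\<in>X. smult (poly r x) (ell x))"
    proof (rule poly_eqI_degree[of X])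
      fix y assume "y \<in> X"
      then show "poly r y = poly (\<Sum>x\<in>X. smult (poly r x) (ell x)) y"
        using fin by (simp add: poly_sum ell if_distrib cong: if_cong)
    next
      show "degree r < card X" using dr card by simp
    next
      have "degree (\<Sum>x\<in>X. smult (poly r x) (ell x)) \<le> N - 1"
      proof (rule degree_sum_le[OF fin])
        fix x assume "x \<in> X"
        then show "degree (smult (poly r x) (ell x)) \<le> N - 1"
          using deg_ell[of x] degree_smult_le[of "poly r x" "ell x"] by linarith
      qed
      then show "degree (\<Sum>x\<in>X. smult (poly r x) (ell x)) < card X" using card N by simp
    qed
    have "jacobi_coord b l p 0 = jacobi_coord b l r 0"
      unfolding pqr jacobi_coord_add jacobi_coord_mult_low_degree[OF dq] by simp
    also have "\<dots> = (\<Sum>x\<in>X. w x * poly r x)"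
      by (subst r) (simp add: jacobi_coord_sum jacobi_coord_smult w_def mult.commute)
    also have "\<dots> = (\<Sum>x\<in>X. w x * poly p x)"
      by (intro sum.cong) (auto simp: pqr X_def)
    finally show ?thesis .
  qed
  have "w x \<ge> 0" if x: "x \<in> X" for x
  proof -
    have nz: "ell x \<noteq> 0" using ell[OF x x] by auto
    have "jacobi_coord b l (ell x * ell x) 0 = (\<Sum>y\<in>X. w y * poly (ell x * ell x) y)"
      using deg_ell[OF x] degree_mult_le[of "ell x" "ell x"] by (intro quad) simp
    also have "\<dots> = (\<Sum>y\<in>X. if y = x then w y else 0)"
      by (intro sum.cong) (auto simp: ell x)
    also have "\<dots> = w x" using x fin by simp
    finally show ?thesis using jacobi_coord_square_pos[of l, OF l nz, of b] by simp
  qed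
  then show ?thesis using quad by blast
qed

lemma finitely_supported_distribution:
  assumes "finite X" and w: "\<And>x. x \<in> X \<Longrightarrow> w x \<ge> 0" and s: "(\<Sum>x\<in>X. w x) = 1"
  shows "\<exists>M. real_distribution M \<and>
    (\<forall>f::real\<Rightarrow>real. f \<in> borel_measurable borel \<longrightarrow> (LINT x|M. f x) = (\<Sum>x\<in>X. w x * f x))"
proof -
  define g where "g x = (if x \<in> X then w x else 0)" for x
  have g0: "g x \<ge> 0" for x using w by (simp add: g_def)
  have "(\<integral>\<^sup>+x. ennreal (g x) \<partial>count_space UNIV) = (\<Sum>x\<in>X. ennreal (g x))"
    using assms(1) by (intro nn_integral_count_space') (auto simp: g_def)
  also have "\<dots> = ennreal (\<Sum>x\<in>X. g x)" using g0 by (simp add: sum_ennreal)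
  also have "(\<Sum>x\<in>X. g x) = 1" using s by (simp add: g_def)
  finally have g1: "(\<integral>\<^sup>+x. ennreal (g x) \<partial>count_space UNIV) = 1" by simp
  define p where "p = embed_pmf g"
  have p: "pmf p x = g x" for x unfolding p_def by (rule pmf_embed_pmf[OF g0 g1])
  define M where "M = distr (measure_pmf p) borel (\<lambda>x. x)"
  have "real_distribution M" unfolding M_def
    by (rule prob_space.real_distribution_distr[OF measure_pmf.prob_space_axioms]) simp
  moreover have "(LINT x|M. f x) = (\<Sum>x\<in>X. w x * f x)" if [measurable]: "f \<in> borel_measurable borel" for f :: "real \<Rightarrow> real"
  proof -
    have "(LINT x|M. f x) = (LINT x|measure_pmf p. f x)"
      unfolding M_def by (subst integral_distr) auto
    also have "\<dots> = (\<Sum>x\<in>X. f x * pmf p x)"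
      using assms(1) by (intro integral_measure_pmf_real) (auto simp: set_pmf_iff p g_def split: if_splits)
    finally show ?thesis by (simp add: p g_def mult.commute)
  qed
  ultimately show ?thesis by blast
qed

lemma continuous_on_poly_real: "continuous_on A (poly (p :: real poly))"
  by (intro continuous_intros)

subsection \<open>Existence\<close>

lemma abs_continuous_le_const:
  fixes f :: "real \<Rightarrow> real"
  assumes "continuous_on {a..b} f"
  shows "\<exists>K. \<forall>y\<in>{a..b}. \<bar>f y\<bar> \<le> K"
  using compact_imp_bounded[OF compact_continuous_image[OF assms compact_Icc]]
  by (auto simp: bounded_iff)

text \<open>
  Favard's theorem for bounded coefficients. The quadrature measures live on a common compact interval,
  so by Helly's theorem a subsequence converges weakly, and moments pass to the limit.
\<close>

lemma jacobi_measure_ex: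
  assumes bd: "jacobi_bounded b l B C"
  shows "\<exists>\<mu>. jacobi_measure b l \<mu>"
proof -
  define R where "R = 1 + B + C"
  have R: "R > 0" using jacobi_boundedD[OF bd] by (simp add: R_def add_pos_nonneg)
  define X where "X N = {x. poly (jacobi_poly b l (Suc N)) x = 0}" for N
  have fin: "finite (X N)" for N unfolding X_def by (rule poly_roots_finite) simp
  have XR: "\<bar>x\<bar> \<le> R" if "x \<in> X N" for x N
    using jacobi_poly_root_bound[of b B l C "Suc N" x] jacobi_boundedD[OF bd] that by (simp add: X_def R_def)
  have "\<exists>w. (\<forall>x\<in>X N. w x \<ge> 0) \<and>
     (\<forall>p. degree p < 2 * Suc N \<longrightarrow> jacobi_coord b l p 0 = (\<Sum>x\<in>X N. w x * poly p x))" for N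
    unfolding X_def using jacobi_boundedD(2)[OF bd] by (intro gauss_quadrature) auto
  then obtain w where w0: "\<And>N x. x \<in> X N \<Longrightarrow> w N x \<ge> 0"
    and quad: "\<And>N p. degree p < 2 * Suc N \<Longrightarrow> jacobi_coord b l p 0 = (\<Sum>x\<in>X N. w N x * poly p x)"
    by metis
  have w1: "(\<Sum>x\<in>X N. w N x) = 1" for N
    using quad[of 1 N] by (simp add: one_pCons jacobi_coord_pCons)
  have "\<exists>M. real_distribution M \<and> (\<forall>f::real\<Rightarrow>real. f \<in> borel_measurable borel \<longrightarrow>
      (LINT x|M. f x) = (\<Sum>x\<in>X N. w N x * f x))" for N
    by (intro finitely_supported_distribution fin w0 w1)
  then obtain M where M: "\<And>N. real_distribution (M N)"
    and Mint: "\<And>N f. (f::real\<Rightarrow>real) \<in> borel_measurable borel \<Longrightarrow> (LINT x|M N. f x) = (\<Sum>x\<in>X N. w N x * f x)"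
    by metis
  have "tight M"
    unfolding tight_def
  proof (intro conjI allI impI)
    fix \<epsilon> :: real assume "0 < \<epsilon>"
    have "1 - \<epsilon> < measure (M N) {-R-1<..R}" for N
    proof -
    interpret real_distribution "M N" by (rule M)
    have "measure (M N) {-R-1<..R} = (LINT x|M N. indicator {-R-1<..R} x)" by simp
    also have "\<dots> = (\<Sum>x\<in>X N. w N x * indicator {-R-1<..R} x)" by (intro Mint) simp
    also have "\<dots> = (\<Sum>x\<in>X N. w N x)"
    proof (intro sum.cong refl)
      fix x assume "x \<in> X N"
      then have "x \<in> {-R-1<..R}" using XR[of x N] by auto
      then show "w N x * indicator {-R-1<..R} x = w N x" by simp
    qed
      finally show ?thesis using w1 \<open>0 < \<epsilon>\<close> by simp
    qed
    then show "\<exists>a b. a < b \<and> (\<forall>n. 1 - \<epsilon> < measure (M n) {a<..b})"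
      using R by (intro exI[of _ "- R - 1"] exI[of _ R]) simp
  qed (rule M)
  then obtain r M' where r: "strict_mono (r :: nat \<Rightarrow> nat)" and M': "real_distribution M'"
    and conv: "weak_conv_m (M \<circ> id \<circ> r) M'"
    using tight_imp_convergent_subsubsequence[of M id] by (auto simp: strict_mono_def)
  interpret M': real_distribution M' by (rule M')
  \<comment> \<open>Clamping to the interval changes no quadrature measure, makes polynomials bounded as weak
    convergence requires, and moves the limit measure into the interval.\<close>
  define cl where "cl y = max (-R) (min R y)" for y
  have cl_cont: "continuous_on UNIV cl" unfolding cl_def by (intro continuous_intros)
  then have cl_meas [measurable]: "cl \<in> borel_measurable borel" by (rule borel_measurable_continuous_onI)
  have cl_R: "cl y \<in> {-R..R}" for y using R by (auto simp: cl_def)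
  define \<mu> where "\<mu> = distr M' borel cl"
  have \<mu>: "prob_space \<mu>" "sets \<mu> = sets borel"
    unfolding \<mu>_def by (auto intro!: M'.prob_space_distr)
  have "integrable \<mu> (poly p) \<and> (LINT y|\<mu>. poly p y) = jacobi_coord b l p 0" for p
  proof -
    have meas [measurable]: "poly p \<in> borel_measurable borel"
      by (intro borel_measurable_continuous_onI continuous_on_poly_real)
    obtain K where K: "\<And>y. y \<in> {-R..R} \<Longrightarrow> \<bar>poly p y\<bar> \<le> K"
      using abs_continuous_le_const[OF continuous_on_poly_real] by blast
    have int: "integrable \<mu> (poly p)"
    proof -
      have "integrable M' (\<lambda>y. poly p (cl y))"
        by (rule M'.integrable_const_bound[of _ K]) (use K cl_R in auto)
      then show ?thesis unfolding \<mu>_def by (subst integrable_distr_eq) auto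
    qed
    have "(\<lambda>n. LINT y|(M \<circ> id \<circ> r) n. poly p (cl y)) \<longlonglongrightarrow> (LINT y|M'. poly p (cl y))"
    proof (rule weak_conv_imp_integral_bdd_continuous_conv[OF _ M' conv])
      show "isCont (\<lambda>y. poly p (cl y)) x" for x
        using cl_cont by (intro continuous_intros) (simp add: continuous_on_eq_continuous_at)
      show "norm (poly p (cl x)) \<le> K" for x using K cl_R by simp
    qed (use M in simp)
    moreover have "\<forall>\<^sub>F n in sequentially. (LINT y|(M \<circ> id \<circ> r) n. poly p (cl y)) = jacobi_coord b l p 0"
      using eventually_ge_at_top[of "degree p"]
    proof eventually_elim
      case (elim n)
      have "(LINT y|(M \<circ> id \<circ> r) n. poly p (cl y)) = (\<Sum>x\<in>X (r n). w (r n) x * poly p (cl x))"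
        by (simp add: Mint)
      also have "\<dots> = (\<Sum>x\<in>X (r n). w (r n) x * poly p x)"
      proof (intro sum.cong refl)
        fix x assume "x \<in> X (r n)"
        then have "cl x = x" using XR[of x "r n"] by (auto simp: cl_def)
        then show "w (r n) x * poly p (cl x) = w (r n) x * poly p x" by simp
      qed
      also have "\<dots> = jacobi_coord b l p 0"
        using elim seq_suble[OF r, of n] by (intro quad[symmetric]) simp
      finally show ?case .
    qed
    ultimately have "(LINT y|M'. poly p (cl y)) = jacobi_coord b l p 0"
      by (intro LIMSEQ_unique[OF _ tendsto_eventually])
    then show ?thesis using int unfolding \<mu>_def by (simp add: integral_distr)
  qed
  with \<mu> show ?thesis unfolding jacobi_measure_def by blast
qed

subsection \<open>Compact support and uniqueness\<close>

text \<open>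
  With \<open>R = 1 + B + C\<close> the \<open>2k\<close>-th moment is at most \<open>R\<^bsup>2k\<^esup>\<close>, so by Markov's inequality the mass outside
  the interval of radius \<open>2 R\<close> is at most \<open>4\<^bsup>-k\<^esup>\<close> for every \<open>k\<close>.
\<close>

lemma jacobi_measure_support:
  assumes bd: "jacobi_bounded b l B C" and \<mu>: "jacobi_measure b l \<mu>"
  shows "AE y in \<mu>. y \<in> {- (2 * (1 + B + C))..2 * (1 + B + C)}"
proof -
  define R where "R = 1 + B + C"
  have R: "R > 0" using jacobi_boundedD[OF bd] by (simp add: R_def add_pos_nonneg)
  interpret real_distribution \<mu> by (rule jacobi_measureD(6)[OF \<mu>])
  define A where "A = {y. \<bar>y\<bar> \<ge> 2 * R}"
  have le: "measure \<mu> A \<le> (1/4) ^ k" for k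
  proof -
    have mono: "poly (monom 1 (2 * k)) = (\<lambda>y::real. y ^ (2 * k))" by (auto simp: poly_monom)
    \<comment> \<open>The measurable set among the premises of Markov's inequality does not occur in its conclusion, so
      the empty set serves.\<close>
    have "measure \<mu> {y \<in> space \<mu>. y ^ (2 * k) \<ge> (2 * R) ^ (2 * k)} \<le> (LINT y|\<mu>. y ^ (2 * k)) / (2 * R) ^ (2 * k)"
      by (rule integral_Markov_inequality_measure[of _ _ "{}"])
         (use R jacobi_measureD(4)[OF \<mu>, of "monom 1 (2 * k)"] mono in auto)
    moreover have "A \<subseteq> {y \<in> space \<mu>. y ^ (2 * k) \<ge> (2 * R) ^ (2 * k)}"
    proof
      fix y assume "y \<in> A"
      then have "(2 * R) ^ (2 * k) \<le> \<bar>y\<bar> ^ (2 * k)" unfolding A_def using R by (intro power_mono) auto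
      then show "y \<in> {y \<in> space \<mu>. y ^ (2 * k) \<ge> (2 * R) ^ (2 * k)}"
        using jacobi_measureD(3)[OF \<mu>] by (simp add: power_even_abs)
    qed
    then have "measure \<mu> A \<le> measure \<mu> {y \<in> space \<mu>. y ^ (2 * k) \<ge> (2 * R) ^ (2 * k)}"
      by (intro finite_measure_mono) auto
    moreover have "(LINT y|\<mu>. y ^ (2 * k)) \<le> R ^ (2 * k)"
      using jacobi_measureD(5)[OF \<mu>, of "monom 1 (2 * k)"] abs_moment_le[of b B l C "2 * k" 0] jacobi_boundedD[OF bd]
      unfolding mono R_def by simp
    then have "(LINT y|\<mu>. y ^ (2 * k)) / (2 * R) ^ (2 * k) \<le> R ^ (2 * k) / (2 * R) ^ (2 * k)"
      using R by (intro divide_right_mono) auto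
    moreover have "R ^ (2 * k) / (2 * R) ^ (2 * k) = (1/4) ^ k"
      using R by (simp add: power_mult power_mult_distrib power_divide)
    ultimately show ?thesis by linarith
  qed
  have "(\<lambda>k. (1/4::real) ^ k) \<longlonglongrightarrow> 0" by (rule LIMSEQ_realpow_zero) auto
  then have "measure \<mu> A \<le> 0" using le by (intro LIMSEQ_le_const) auto
  then have "measure \<mu> A = 0" by (simp add: measure_le_0_iff)
  moreover have "A \<in> sets \<mu>" unfolding A_def by simp
  ultimately have "A \<in> null_sets \<mu>" by (simp add: null_setsI emeasure_eq_measure)
  then show ?thesis
    by (rule AE_I') (auto simp: A_def R_def)
qed

lemma polynomial_approximation:
  fixes f :: "real \<Rightarrow> real"
  assumes "continuous_on {a..b} f" "\<epsilon> > 0"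
  obtains p where "\<And>y. y \<in> {a..b} \<Longrightarrow> \<bar>f y - poly p y\<bar> < \<epsilon>"
proof -
  obtain g where g: "real_polynomial_function g" "\<And>x. x \<in> {a..b} \<Longrightarrow> \<bar>f x - g x\<bar> < \<epsilon>"
    using Stone_Weierstrass_real_polynomial_function[of "{a..b}" f \<epsilon>] assms by auto
  then obtain c n where "g = (\<lambda>x. \<Sum>i\<le>n. c i * x ^ i)"
    by (auto simp: real_polynomial_function_iff_sum)
  then have "g x = poly (\<Sum>i\<le>n. monom (c i) i) x" for x by (simp add: poly_sum poly_monom)
  then show thesis using g(2) that by metis
qed

lemma integrable_compact_support:
  fixes f :: "real \<Rightarrow> real"
  assumes "prob_space \<mu>" "sets \<mu> = sets borel" "AE y in \<mu>. y \<in> {a..b}" "continuous_on UNIV f"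
  shows "integrable \<mu> f"
proof -
  interpret prob_space \<mu> by fact
  obtain K where K: "\<And>y. y \<in> {a..b} \<Longrightarrow> \<bar>f y\<bar> \<le> K"
    using abs_continuous_le_const[of a b f] assms(4) continuous_on_subset by blast
  have "f \<in> borel_measurable \<mu>"
    using borel_measurable_continuous_onI[OF assms(4)] assms(2) by (simp cong: measurable_cong_sets)
  then show ?thesis using K assms(3) by (intro integrable_const_bound[of _ K]) auto
qed

lemma abs_integral_le_of_AE:
  fixes f g :: "real \<Rightarrow> real"
  assumes "integrable \<mu> f" "integrable \<mu> g" "AE y in \<mu>. \<bar>f y\<bar> \<le> g y"
  shows "\<bar>LINT y|\<mu>. f y\<bar> \<le> (LINT y|\<mu>. g y)"
proof -
  have "\<bar>LINT y|\<mu>. f y\<bar> \<le> (LINT y|\<mu>. \<bar>f y\<bar>)" by (rule integral_abs_bound)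
  also have "\<dots> \<le> (LINT y|\<mu>. g y)" using assms by (intro integral_mono_AE) auto
  finally show ?thesis .
qed

lemma integral_eq_of_polynomial_integrals:
  fixes f :: "real \<Rightarrow> real"
  assumes \<mu>: "prob_space \<mu>" "sets \<mu> = sets borel" "AE y in \<mu>. y \<in> {a..b}"
    and \<nu>: "prob_space \<nu>" "sets \<nu> = sets borel" "AE y in \<nu>. y \<in> {a..b}"
    and eq: "\<And>p. (LINT y|\<mu>. poly p y) = (LINT y|\<nu>. poly p y)"
    and f: "continuous_on UNIV f"
  shows "(LINT y|\<mu>. f y) = (LINT y|\<nu>. f y)"
proof (rule ccontr)
  assume ne: "\<not> ?thesis"
  define \<epsilon> where "\<epsilon> = \<bar>(LINT y|\<mu>. f y) - (LINT y|\<nu>. f y)\<bar> / 3"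
  have \<epsilon>: "\<epsilon> > 0" using ne by (simp add: \<epsilon>_def)
  obtain p where p: "\<And>y. y \<in> {a..b} \<Longrightarrow> \<bar>f y - poly p y\<bar> < \<epsilon>"
    using polynomial_approximation[of a b f \<epsilon>] f \<epsilon> continuous_on_subset by blast
  have *: "\<bar>(LINT y|M. f y) - (LINT y|M. poly p y)\<bar> \<le> \<epsilon>"
    if M: "prob_space M" "sets M = sets borel" "AE y in M. y \<in> {a..b}" for M
  proof -
    interpret prob_space M by fact
    have int: "integrable M f" "integrable M (poly p)"
      by (rule integrable_compact_support[OF M], intro f continuous_on_poly_real)+
    have "\<bar>LINT y|M. f y - poly p y\<bar> \<le> (LINT y|M. \<epsilon>)"
    proof (rule abs_integral_le_of_AE)
      show "AE y in M. \<bar>f y - poly p y\<bar> \<le> \<epsilon>"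
        using M(3) by eventually_elim (use p in \<open>auto intro: less_imp_le\<close>)
    qed (use int in auto)
    then show ?thesis using int by (simp add: prob_space)
  qed
  have "\<bar>(LINT y|\<mu>. f y) - (LINT y|\<nu>. f y)\<bar> \<le> 2 * \<epsilon>"
    using *[OF \<mu>] *[OF \<nu>] eq[of p] by linarith
  also have "\<dots> < 3 * \<epsilon>" using \<epsilon> by simp
  also have "\<dots> = \<bar>(LINT y|\<mu>. f y) - (LINT y|\<nu>. f y)\<bar>" by (simp add: \<epsilon>_def)
  finally show False by simp
qed

lemma jacobi_measure_unique:
  assumes bd: "jacobi_bounded b l B C" and \<mu>: "jacobi_measure b l \<mu>" and \<nu>: "jacobi_measure b l \<nu>"
  shows "\<mu> = \<nu>"
proof -
  let ?R = "2 * (1 + B + C)"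
  have eq: "(LINT y|\<mu>. f y) = (LINT y|\<nu>. f y)" if "continuous_on UNIV f" for f :: "real \<Rightarrow> real"
    by (rule integral_eq_of_polynomial_integrals[of _ "- ?R" ?R])
       (use that \<mu> \<nu> jacobi_measureD jacobi_measure_support[OF bd] in auto)
  have "char \<mu> = char \<nu>"
  proof
    fix t
    have *: "char M t = Complex (LINT y|M. cos (t * y)) (LINT y|M. sin (t * y))"
      if "jacobi_measure b l M" for M
    proof -
      interpret real_distribution M by (rule jacobi_measureD(6)[OF that])
      have int: "integrable M (\<lambda>x. iexp (t * x))"
        by (intro integrable_iexp) auto
      have "Re (char M t) = (LINT y|M. cos (t * y))" "Im (char M t) = (LINT y|M. sin (t * y))"
        unfolding char_def integral_Re[OF int, symmetric] integral_Im[OF int, symmetric] by (simp_all add: Re_exp Im_exp)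
      then show ?thesis by (simp add: complex_eq_iff)
    qed
    show "char \<mu> t = char \<nu> t"
      unfolding *[OF \<mu>] *[OF \<nu>] by (intro arg_cong2[of _ _ _ _ Complex] eq continuous_intros)
  qed
  then show ?thesis
    by (intro Levy_uniqueness jacobi_measureD(6)[OF \<mu>] jacobi_measureD(6)[OF \<nu>])
qed

lemma the_orthogonality_measure:
  assumes bd: "jacobi_bounded b l B C"
  shows "jacobi_measure b l (THE \<mu>. orthogonality_measure (jacobi_poly b l) \<mu>)"
proof -
  have "\<exists>!\<mu>. jacobi_measure b l \<mu>"
    using jacobi_measure_ex[OF bd] jacobi_measure_unique[OF bd] by blast
  then show ?thesis
    unfolding orthogonality_measure_iff_jacobi_measure by (rule theI')
qed

section \<open>The second order Taylor quotient\<close>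

text \<open>
  Twice continuously differentiable on the whole line, in terms of the total function \<open>deriv\<close>.
\<close>

definition twice_cont_diff :: "(real \<Rightarrow> real) \<Rightarrow> bool" where
  "twice_cont_diff f \<longleftrightarrow> (\<forall>y. (f has_real_derivative deriv f y) (at y)) \<and>
     (\<forall>y. (deriv f has_real_derivative deriv (deriv f) y) (at y)) \<and>
     continuous_on UNIV (deriv (deriv f))"

text \<open>
  The second order Taylor quotient of \<open>f\<close> at \<open>x\<close>, extended to \<open>y = x\<close> by its limit \<open>f''(x) / 2\<close>. Off the
  diagonal it equals the \<open>x\<close>-derivative of \<open>(f(y) - f(x)) / (y - x)\<close>.
\<close>

definition taylor_quot :: "(real \<Rightarrow> real) \<Rightarrow> real \<Rightarrow> real \<Rightarrow> real" where
  "taylor_quot f x y = (if y = x then deriv (deriv f) x / 2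
     else (f y - f x - deriv f x * (y - x)) / (y - x)\<^sup>2)"

lemma taylor_expansion: "f y = f x + deriv f x * (y - x) + (y - x)\<^sup>2 * taylor_quot f x y"
  by (auto simp: taylor_quot_def)

lemma taylor_quot_mean_value:
  assumes "twice_cont_diff f"
  shows "\<exists>\<xi>. \<bar>\<xi> - x\<bar> \<le> \<bar>y - x\<bar> \<and> taylor_quot f x y = deriv (deriv f) \<xi> / 2"
proof (cases "y = x")
  case False
  define D where "D = (\<lambda>m::nat. if m = 0 then f else if m = 1 then deriv f else deriv (deriv f))"
  have "\<exists>t. (if y < x then y < t \<and> t < x else x < t \<and> t < y) \<and>
    f y = (\<Sum>m<2. (D m x / fact m) * (y - x)^m) + (D 2 t / fact 2) * (y - x)^2"
  proof (rule Taylor[where a = "min x y" and b = "max x y"])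
    show "\<forall>m t. m < 2 \<and> min x y \<le> t \<and> t \<le> max x y \<longrightarrow> DERIV (D m) t :> D (Suc m) t"
      using assms by (auto simp: D_def twice_cont_diff_def less_2_cases_iff)
  qed (use False in \<open>auto simp: D_def\<close>)
  then obtain t where t: "if y < x then y < t \<and> t < x else x < t \<and> t < y"
    and eq: "f y = (\<Sum>m<2. (D m x / fact m) * (y - x)^m) + (D 2 t / fact 2) * (y - x)^2" by blast
  have "f y = f x + deriv f x * (y - x) + deriv (deriv f) t / 2 * (y - x)\<^sup>2"
    using eq by (simp add: D_def numeral_2_eq_2)
  then have "taylor_quot f x y = deriv (deriv f) t / 2"
    using False by (simp add: taylor_quot_def)
  moreover have "\<bar>t - x\<bar> \<le> \<bar>y - x\<bar>" using t by (auto split: if_splits)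
  ultimately show ?thesis by blast
qed (auto simp: taylor_quot_def)

lemma continuous_on_taylor_quot:
  assumes f: "twice_cont_diff f"
  shows "continuous_on UNIV (taylor_quot f x)"
proof -
  have "isCont (taylor_quot f x) y" for y
  proof (cases "y = x")
    case False
    have "isCont f y" using f DERIV_isCont unfolding twice_cont_diff_def by blast
    then have "isCont (\<lambda>y. (f y - f x - deriv f x * (y - x)) / (y - x)\<^sup>2) y"
      using False by (intro continuous_intros) auto
    moreover have "\<forall>\<^sub>F z in nhds y. taylor_quot f x z = (f z - f x - deriv f x * (z - x)) / (z - x)\<^sup>2"
      using t1_space_nhds[OF False] by eventually_elim (simp add: taylor_quot_def)
    ultimately show ?thesis by (simp add: isCont_cong)
  next
    case True
    show ?thesis unfolding True continuous_at_eps_delta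
    proof (intro allI impI)
      fix e :: real assume "e > 0"
      have "isCont (deriv (deriv f)) x"
        using f by (simp add: twice_cont_diff_def continuous_on_eq_continuous_at)
      then obtain d where d: "d > 0" "\<And>z. \<bar>z - x\<bar> < d \<Longrightarrow> \<bar>deriv (deriv f) z - deriv (deriv f) x\<bar> < e"
        using \<open>e > 0\<close> unfolding continuous_at_eps_delta dist_real_def by metis
      have "\<bar>taylor_quot f x z - taylor_quot f x x\<bar> < e" if "\<bar>z - x\<bar> < d" for z
      proof -
        obtain \<xi> where \<xi>: "\<bar>\<xi> - x\<bar> \<le> \<bar>z - x\<bar>" "taylor_quot f x z = deriv (deriv f) \<xi> / 2"
          using taylor_quot_mean_value[OF f] by blast
        have "taylor_quot f x x = deriv (deriv f) x / 2" by (simp add: taylor_quot_def)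
        then show ?thesis using d(2)[of \<xi>] \<xi> that by linarith
      qed
      then show "\<exists>d>0. \<forall>x'. dist x' x < d \<longrightarrow> dist (taylor_quot f x x') (taylor_quot f x x) < e"
        using d(1) by (auto simp: dist_real_def)
    qed
  qed
  then show ?thesis by (simp add: continuous_at_imp_continuous_on)
qed

lemma dd_deriv_eq_taylor_quot:
  assumes f: "twice_cont_diff f" and "y \<noteq> x"
  shows "dd_deriv f x y = taylor_quot f x y"
proof -
  have "(f has_real_derivative deriv f x) (at x)" using f by (simp add: twice_cont_diff_def)
  then have "((\<lambda>z. (f y - f z) / (y - z)) has_real_derivative
      ((0 - deriv f x) * (y - x) - (f y - f x) * (0 - 1)) / ((y - x) * (y - x))) (at x)"
    by (rule DERIV_divide[OF DERIV_diff[OF DERIV_const] DERIV_diff[OF DERIV_const DERIV_ident]])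
       (use \<open>y \<noteq> x\<close> in auto)
  then show ?thesis
    unfolding dd_deriv_def using \<open>y \<noteq> x\<close>
    by (subst DERIV_imp_deriv) (auto simp: taylor_quot_def power2_eq_square algebra_simps)
qed

lemma deriv_poly: "deriv (poly p) = poly (pderiv p)" for p :: "real poly"
  by (intro ext DERIV_imp_deriv poly_DERIV)

lemma twice_cont_diff_poly: "twice_cont_diff (poly p)"
  by (auto simp: twice_cont_diff_def deriv_poly intro!: poly_DERIV continuous_intros)

text \<open>
  With \<open>D(x) = (f(y) - f(x)) / (y - x)\<close> as a polynomial in \<open>x\<close>, differentiating
  \<open>(y - x) D(x) = f(y) - f(x)\<close> once gives the claim for \<open>y \<noteq> x\<close>, and twice gives it for \<open>y = x\<close>.
\<close>

lemma dd_poly_deriv_eq_taylor_quot: "dd_poly_deriv f x y = taylor_quot (poly f) x y"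
proof -
  define d where "d = dd_poly f y"
  define X where "X = [:y, - 1:]"
  have polyX: "poly X x = y - x" by (simp add: X_def)
  have "pderiv X = [:- 1:]" by (simp add: X_def pderiv_pCons)
  then have pderivX: "pderiv (X * g) = X * pderiv g - g" for g
    by (simp add: pderiv_mult)
  have "X dvd [:poly f y:] - f"
  proof -
    have X: "X = smult (-1) [:-y, 1:]" by (simp add: X_def)
    have "[:-y, 1:] dvd [:poly f y:] - f" by (simp add: poly_eq_0_iff_dvd[symmetric])
    then show ?thesis unfolding X by (simp only: smult_dvd_iff) simp
  qed
  then have eq0: "X * d = [:poly f y:] - f"
    unfolding d_def dd_poly_def X_def by (rule dvd_mult_div_cancel)
  have "pderiv (X * d) = - pderiv f" unfolding eq0 by (simp add: pderiv_diff pderiv_pCons)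
  then have eq1: "X * pderiv d - d = - pderiv f" by (simp only: pderivX)
  have "pderiv (X * pderiv d - d) = - pderiv (pderiv f)" unfolding eq1 by (rule pderiv_minus)
  then have eq2: "X * pderiv (pderiv d) - pderiv d - pderiv d = - pderiv (pderiv f)"
    by (simp only: pderivX pderiv_diff)
  have 0: "(y - x) * poly d x = poly f y - poly f x"
    using arg_cong[OF eq0, of "\<lambda>p. poly p x"] by (simp add: polyX)
  have 1: "(y - x) * poly (pderiv d) x - poly d x = - poly (pderiv f) x"
    using arg_cong[OF eq1, of "\<lambda>p. poly p x"] by (simp add: polyX)
  have 2: "(y - x) * poly (pderiv (pderiv d)) x - 2 * poly (pderiv d) x = - poly (pderiv (pderiv f)) x"
    using arg_cong[OF eq2, of "\<lambda>p. poly p x"] by (simp add: polyX)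
  show ?thesis
  proof (cases "y = x")
    case True
    then show ?thesis using 2 by (simp add: taylor_quot_def dd_poly_deriv_def deriv_poly d_def)
  next
    case False
    have "(y - x)\<^sup>2 * poly (pderiv d) x = (y - x) * (poly d x - poly (pderiv f) x)"
      using 1 by (simp add: power2_eq_square)
    also have "\<dots> = poly f y - poly f x - poly (pderiv f) x * (y - x)"
      using 0 by (simp add: right_diff_distrib mult.commute)
    finally show ?thesis
      using False by (simp add: taylor_quot_def dd_poly_deriv_def deriv_poly d_def field_simps)
  qed
qed

section \<open>Increments over short times\<close>

text \<open>
  If \<open>l\<^sub>0 = 0\<close>, the multiples of \<open>y - b\<^sub>0\<close> form an invariant subspace, on which multiplication by \<open>y\<close> is
  given by the shifted coefficients.
\<close>

lemma jacobi_coord_shift: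
  assumes "l 0 = 0"
  shows "jacobi_coord b l ([:- b 0, 1:] * p) =
    (\<lambda>j. case j of 0 \<Rightarrow> 0 | Suc i \<Rightarrow> jacobi_coord (\<lambda>n. b (Suc n)) (\<lambda>n. l (Suc n)) p i)"
proof (induction p)
  case (pCons a p)
  have "[:- b 0, 1:] * pCons a p = smult a (jacobi_poly b l 1) + pCons 0 ([:- b 0, 1:] * p)"
    by (simp add: algebra_simps)
  then have "jacobi_coord b l ([:- b 0, 1:] * pCons a p) =
      (\<lambda>j. a * (if j = 1 then 1 else 0) + jacobi_op b l (jacobi_coord b l ([:- b 0, 1:] * p)) j)"
    by (simp only: jacobi_coord_add jacobi_coord_smult jacobi_coord_jacobi_poly jacobi_coord_pCons) (simp add: fun_eq_iff)
  then show ?case unfolding pCons.IH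
    by (auto simp: fun_eq_iff jacobi_coord_pCons jacobi_op_def assms split: nat.split)
qed (auto split: nat.split)

lemma tendsto_jacobi_coord:
  assumes "\<And>n. ((\<lambda>h. l h n) \<longlongrightarrow> k n) F"
  shows "((\<lambda>h. jacobi_coord b (l h) p j) \<longlongrightarrow> jacobi_coord b k p j) F"
proof (induction p arbitrary: j)
  case (pCons a p)
  have "((\<lambda>h. case j of 0 \<Rightarrow> 0 | Suc i \<Rightarrow> jacobi_coord b (l h) p i) \<longlongrightarrow>
    (case j of 0 \<Rightarrow> 0 | Suc i \<Rightarrow> jacobi_coord b k p i)) F"
    using pCons.IH by (cases j) auto
  then show ?case unfolding jacobi_coord_pCons jacobi_op_def
    by (intro tendsto_intros pCons.IH assms) auto
qed simp

text \<open>
  Since \<open>y - b\<^sub>0 = P\<^sub>1\<close>, this is the pairing of \<open>(y - b\<^sub>0) p\<close> with \<open>P\<^sub>1\<close>.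
\<close>

lemma integral_square_times_poly:
  assumes \<mu>: "jacobi_measure b l \<mu>"
  shows "(LINT y|\<mu>. (y - b 0)\<^sup>2 * poly p y) = l 0 * jacobi_coord b l ([:- b 0, 1:] * p) 1"
proof -
  have "(\<lambda>y. (y - b 0)\<^sup>2 * poly p y) = poly (([:- b 0, 1:] * p) * jacobi_poly b l 1)"
    by (auto simp: power2_eq_square algebra_simps)
  then have "(LINT y|\<mu>. (y - b 0)\<^sup>2 * poly p y) = jacobi_coord b l (([:- b 0, 1:] * p) * jacobi_poly b l 1) 0"
    by (simp only: jacobi_measureD(5)[OF \<mu>])
  then show ?thesis by (simp only: jacobi_coord_mult_jacobi_poly) (simp add: jacobi_weight_def)
qed

lemma integral_square:
  assumes \<mu>: "jacobi_measure b l \<mu>"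
  shows "(LINT y|\<mu>. (y - b 0)\<^sup>2) = l 0"
  using integral_square_times_poly[OF \<mu>, of 1] jacobi_coord_jacobi_poly[of b l 1] by simp

lemma integrable_jacobi_measure:
  assumes "jacobi_bounded b l B C" "jacobi_measure b l \<mu>" "continuous_on UNIV f"
  shows "integrable \<mu> (f :: real \<Rightarrow> real)"
  using integrable_compact_support[OF jacobi_measureD(1,2)[OF assms(2)] jacobi_measure_support[OF assms(1,2)] assms(3)] .

text \<open>
  The mean of the measure is \<open>b\<^sub>0\<close>, so the first order term of the Taylor expansion integrates to 0.
\<close>

lemma integral_increment:
  assumes bd: "jacobi_bounded b l B C" and \<mu>: "jacobi_measure b l \<mu>" and f: "twice_cont_diff f"
  shows "(LINT y|\<mu>. f y) - f (b 0) = (LINT y|\<mu>. (y - b 0)\<^sup>2 * taylor_quot f (b 0) y)"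
proof -
  let ?x = "b 0"
  interpret prob_space \<mu> by (rule jacobi_measureD(1)[OF \<mu>])
  note int = integrable_jacobi_measure[OF bd \<mu>]
  have lin: "poly [:- ?x, 1:] = (\<lambda>y. y - ?x)" by (auto simp: algebra_simps)
  have mean: "(LINT y|\<mu>. y - ?x) = 0"
    using jacobi_measureD(5)[OF \<mu>, of "jacobi_poly b l 1"] jacobi_coord_jacobi_poly[of b l 1] by (simp add: lin)
  have "(LINT y|\<mu>. f y) = (LINT y|\<mu>. f ?x + deriv f ?x * (y - ?x) + (y - ?x)\<^sup>2 * taylor_quot f ?x y)"
    by (intro Bochner_Integration.integral_cong refl taylor_expansion)
  also have "\<dots> = (LINT y|\<mu>. f ?x + deriv f ?x * (y - ?x)) + (LINT y|\<mu>. (y - ?x)\<^sup>2 * taylor_quot f ?x y)"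
    by (intro Bochner_Integration.integral_add int continuous_intros continuous_on_taylor_quot f)
  also have "(LINT y|\<mu>. f ?x + deriv f ?x * (y - ?x)) = (LINT y|\<mu>. f ?x) + (LINT y|\<mu>. deriv f ?x * (y - ?x))"
    by (intro Bochner_Integration.integral_add int continuous_intros)
  finally show ?thesis using mean by (simp add: prob_space)
qed

lemma abs_integral_increment_le:
  assumes bd: "jacobi_bounded b l B C" and \<mu>: "jacobi_measure b l \<mu>" and f: "twice_cont_diff f"
    and K: "\<And>y. \<bar>deriv (deriv f) y\<bar> \<le> K"
  shows "\<bar>(LINT y|\<mu>. f y) - f (b 0)\<bar> \<le> K / 2 * l 0"
proof -
  have tq: "\<bar>taylor_quot f (b 0) y\<bar> \<le> K / 2" for y
  proof -
    obtain \<xi> where "taylor_quot f (b 0) y = deriv (deriv f) \<xi> / 2"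
      using taylor_quot_mean_value[OF f] by blast
    then show ?thesis using K[of \<xi>] by simp
  qed
  have "\<bar>LINT y|\<mu>. (y - b 0)\<^sup>2 * taylor_quot f (b 0) y\<bar> \<le> (LINT y|\<mu>. K / 2 * (y - b 0)\<^sup>2)"
  proof (rule abs_integral_le_of_AE)
    show "AE y in \<mu>. \<bar>(y - b 0)\<^sup>2 * taylor_quot f (b 0) y\<bar> \<le> K / 2 * (y - b 0)\<^sup>2"
    proof (rule AE_I2)
      show "\<bar>(y - b 0)\<^sup>2 * taylor_quot f (b 0) y\<bar> \<le> K / 2 * (y - b 0)\<^sup>2" for y
        using mult_right_mono[OF tq[of y], of "(y - b 0)\<^sup>2"] by (simp add: abs_mult mult.commute)
    qed
  qed (intro integrable_jacobi_measure[OF bd \<mu>] continuous_intros continuous_on_taylor_quot f)+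
  then show ?thesis by (simp add: integral_increment[OF bd \<mu> f] integral_square[OF \<mu>])
qed

text \<open>
  The measures \<open>(y - b\<^sub>0)\<^sup>2 \<mu>\<^sub>h(dy) / l\<^sub>h\<^sub>,\<^sub>0\<close> are probability measures on a common compact interval. As
  the coefficients converge to \<open>k\<close> with \<open>k\<^sub>0 = 0\<close>, their moments converge to those of the measure of
  the shifted limit coefficients. The approximation of the Taylor quotient by a polynomial on the interval
  transfers the convergence from moments to the Taylor quotient.
\<close>

lemma increment_quotient_tendsto:
  assumes bd: "\<forall>\<^sub>F h in F. jacobi_bounded b (l h) B C"
    and \<mu>: "\<forall>\<^sub>F h in F. jacobi_measure b (l h) (\<mu> h)"
    and bd0: "jacobi_bounded (\<lambda>n. b (Suc n)) (\<lambda>n. k (Suc n)) B C"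
    and \<nu>: "jacobi_measure (\<lambda>n. b (Suc n)) (\<lambda>n. k (Suc n)) \<nu>"
    and k0: "k 0 = 0" and lim: "\<And>n. ((\<lambda>h. l h n) \<longlongrightarrow> k n) F"
    and f: "twice_cont_diff f"
  shows "((\<lambda>h. ((LINT y|\<mu> h. f y) - f (b 0)) / l h 0) \<longlongrightarrow> (LINT y|\<nu>. taylor_quot f (b 0) y)) F"
proof (rule tendstoI)
  fix e :: real assume "e > 0"
  let ?x = "b 0" and ?S = "2 * (1 + B + C)"
  let ?g = "taylor_quot f ?x"
  note g = continuous_on_taylor_quot[OF f]
  have "continuous_on {- ?S..?S} ?g" using g by (rule continuous_on_subset) simp
  moreover have "e / 3 > 0" using \<open>e > 0\<close> by simp
  ultimately obtain p where p: "\<And>y. y \<in> {- ?S..?S} \<Longrightarrow> \<bar>?g y - poly p y\<bar> < e / 3"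
    using polynomial_approximation by blast
  interpret \<nu>: prob_space \<nu> by (rule jacobi_measureD(1)[OF \<nu>])
  have \<nu>_close: "\<bar>(LINT y|\<nu>. ?g y) - (LINT y|\<nu>. poly p y)\<bar> \<le> e / 3"
  proof -
    note int = integrable_jacobi_measure[OF bd0 \<nu>]
    have "\<bar>LINT y|\<nu>. ?g y - poly p y\<bar> \<le> (LINT y|\<nu>. e / 3)"
    proof (rule abs_integral_le_of_AE)
      show "AE y in \<nu>. \<bar>?g y - poly p y\<bar> \<le> e / 3"
        using jacobi_measure_support[OF bd0 \<nu>] by eventually_elim (use p in \<open>auto intro: less_imp_le\<close>)
    qed (intro int continuous_intros g)+
    then show ?thesis using int[OF g] int[OF continuous_on_poly_real] by (simp add: \<nu>.prob_space)
  qed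
  have "((\<lambda>h. jacobi_coord b (l h) ([:- ?x, 1:] * p) 1) \<longlongrightarrow> jacobi_coord b k ([:- ?x, 1:] * p) 1) F"
    by (intro tendsto_jacobi_coord lim)
  moreover have "jacobi_coord b k ([:- ?x, 1:] * p) 1 = (LINT y|\<nu>. poly p y)"
    unfolding jacobi_coord_shift[of k b p, OF k0] using jacobi_measureD(5)[OF \<nu>, of p] by simp
  ultimately have "((\<lambda>h. jacobi_coord b (l h) ([:- ?x, 1:] * p) 1) \<longlongrightarrow> (LINT y|\<nu>. poly p y)) F" by simp
  then have "\<forall>\<^sub>F h in F. dist (jacobi_coord b (l h) ([:- ?x, 1:] * p) 1) (LINT y|\<nu>. poly p y) < e / 3"
    using \<open>e > 0\<close> by (intro tendstoD) auto
  then show "\<forall>\<^sub>F h in F. dist (((LINT y|\<mu> h. f y) - f (b 0)) / l h 0) (LINT y|\<nu>. ?g y) < e"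
    using bd \<mu>
  proof eventually_elim
    case (elim h)
    note bdh = elim(2) and \<mu>h = elim(3)
    note int = integrable_jacobi_measure[OF bdh \<mu>h]
    have lpos: "l h 0 > 0" by (rule jacobi_boundedD(2)[OF bdh])
    have "\<bar>LINT y|\<mu> h. (y - ?x)\<^sup>2 * ?g y - (y - ?x)\<^sup>2 * poly p y\<bar> \<le> (LINT y|\<mu> h. e / 3 * (y - ?x)\<^sup>2)"
    proof (rule abs_integral_le_of_AE)
      show "AE y in \<mu> h. \<bar>(y - ?x)\<^sup>2 * ?g y - (y - ?x)\<^sup>2 * poly p y\<bar> \<le> e / 3 * (y - ?x)\<^sup>2"
        using jacobi_measure_support[OF bdh \<mu>h]
      proof eventually_elim
        case (elim y)
        have "\<bar>(y - ?x)\<^sup>2 * ?g y - (y - ?x)\<^sup>2 * poly p y\<bar> = \<bar>?g y - poly p y\<bar> * (y - ?x)\<^sup>2"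
          unfolding right_diff_distrib[symmetric] abs_mult by simp
        also have "\<dots> \<le> e / 3 * (y - ?x)\<^sup>2" using p[OF elim] by (intro mult_right_mono) auto
        finally show ?case .
      qed
    qed (intro int continuous_intros g)+
    also have "(LINT y|\<mu> h. e / 3 * (y - ?x)\<^sup>2) = e / 3 * l h 0"
      by (simp add: integral_square[OF \<mu>h])
    also have "(LINT y|\<mu> h. (y - ?x)\<^sup>2 * ?g y - (y - ?x)\<^sup>2 * poly p y) =
        ((LINT y|\<mu> h. f y) - f ?x) - l h 0 * jacobi_coord b (l h) ([:- ?x, 1:] * p) 1"
      unfolding integral_increment[OF bdh \<mu>h f] integral_square_times_poly[OF \<mu>h, symmetric]
      by (intro Bochner_Integration.integral_diff int continuous_intros g)
    also have "\<dots> = (((LINT y|\<mu> h. f y) - f ?x) / l h 0 - jacobi_coord b (l h) ([:- ?x, 1:] * p) 1) * l h 0"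
      using lpos by (simp add: field_simps)
    finally have "\<bar>((LINT y|\<mu> h. f y) - f ?x) / l h 0 - jacobi_coord b (l h) ([:- ?x, 1:] * p) 1\<bar> \<le> e / 3"
      using lpos by (simp add: abs_mult)
    then show ?case using \<nu>_close elim(1) unfolding dist_real_def by linarith
  qed
qed

section \<open>The generators of the q-Meixner process\<close>

text \<open>
  The diagonal Jacobi coefficients of the transition probabilities; they do not depend on the times.
\<close>

definition meixner_b :: "real \<Rightarrow> real \<Rightarrow> real \<Rightarrow> nat \<Rightarrow> real" where
  "meixner_b \<theta> q x n = \<theta> * q_nat q n + x * q ^ n"

text \<open>
  The coefficient of \<open>Q\<^sub>n\<close> in \<open>y Q\<^sub>n\<^sub>+\<^sub>1\<close>; in particular the first one is \<open>t - s\<close>.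
\<close>

definition meixner_l :: "real \<Rightarrow> real \<Rightarrow> real \<Rightarrow> real \<Rightarrow> nat \<Rightarrow> real" where
  "meixner_l \<tau> q s t n = (t - s * q ^ n + \<tau> * q_nat q n) * q_nat q (n + 1)"

lemma Q_poly_eq_jacobi_poly:
  "Q_poly \<theta> \<tau> q x s t n = jacobi_poly (meixner_b \<theta> q x) (meixner_l \<tau> q s t) n"
  by (induction \<theta> \<tau> q x s t n rule: Q_poly.induct)
     (simp_all add: meixner_b_def meixner_l_def q_nat_def del: mult_pCons_left)

lemma one_minus_power_eq_q_nat: "1 - q ^ n = (1 - q) * q_nat q n"
  unfolding q_nat_def by (rule one_diff_power_eq)

text \<open>
  The polynomials of \<open>\<nu>\<close> have the coefficients of the transition probabilities at equal times, shifted by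
  one: \<open>t - t q\<^bsup>n\<^esup> = (1 - q) t [n]\<^sub>q\<close>.
\<close>

lemma W_poly_eq_jacobi_poly:
  "W_poly \<theta> \<tau> q x t n =
    jacobi_poly (\<lambda>n. meixner_b \<theta> q x (Suc n)) (\<lambda>n. meixner_l \<tau> q t t (Suc n)) n"
proof (induction \<theta> \<tau> q x t n rule: W_poly.induct)
  case (3 \<theta> \<tau> q x t n)
  have "meixner_l \<tau> q t t (Suc n) = ((1 - q) * t + \<tau>) * q_nat q (n + 1) * q_nat q (n + 2)"
  proof -
    have "t - t * q ^ Suc n = t * (1 - q ^ Suc n)" by (simp add: right_diff_distrib)
    also have "\<dots> = t * ((1 - q) * q_nat q (n + 1))" by (simp only: one_minus_power_eq_q_nat Suc_eq_plus1)
    finally have "t - t * q ^ Suc n = t * ((1 - q) * q_nat q (n + 1))" .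
    then show ?thesis unfolding meixner_l_def by (simp only:) (simp add: algebra_simps)
  qed
  moreover have "meixner_b \<theta> q x (Suc (Suc n)) = \<theta> * q_nat q (n + 2) + x * q ^ (n + 2)"
    by (simp add: meixner_b_def)
  ultimately show ?case using 3 by (simp del: mult_pCons_left)
qed (simp_all add: meixner_b_def)

context
  fixes q :: real
  assumes q: "- 1 < q" "q < 1"
begin

lemma abs_q_less_1: "\<bar>q\<bar> < 1" using q by auto

lemma abs_q_power_le_1: "\<bar>q ^ n\<bar> \<le> 1"
  using abs_q_less_1 by (simp add: power_abs power_le_one)

lemma abs_q_power_Suc_less_1: "\<bar>q ^ Suc n\<bar> < 1"
proof -
  have "\<bar>q\<bar> * \<bar>q ^ n\<bar> \<le> \<bar>q\<bar> * 1" using abs_q_power_le_1 by (intro mult_left_mono) auto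
  then show ?thesis using abs_q_less_1 by (simp add: abs_mult)
qed

lemma q_nat_eq: "q_nat q n = (1 - q ^ n) / (1 - q)"
  using one_minus_power_eq_q_nat[of q n] q by (simp add: field_simps)

lemma q_nat_nonneg: "0 \<le> q_nat q n"
  unfolding q_nat_eq using q abs_q_power_le_1[of n] by (auto intro!: divide_nonneg_pos)

lemma q_nat_Suc_pos: "0 < q_nat q (Suc n)"
  unfolding q_nat_eq using q abs_q_power_Suc_less_1[of n] by (intro divide_pos_pos) linarith+

lemma q_nat_le: "q_nat q n \<le> 2 / (1 - q)"
  unfolding q_nat_eq using q abs_q_power_le_1[of n] by (intro divide_right_mono) auto

lemma abs_meixner_b_le: "\<bar>meixner_b \<theta> q x n\<bar> \<le> \<bar>\<theta>\<bar> * (2 / (1 - q)) + \<bar>x\<bar>"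
proof -
  have "\<bar>\<theta> * q_nat q n\<bar> \<le> \<bar>\<theta>\<bar> * (2 / (1 - q))"
    unfolding abs_mult using q_nat_nonneg[of n] q_nat_le[of n] by (intro mult_left_mono) auto
  moreover have "\<bar>x * q ^ n\<bar> \<le> \<bar>x\<bar> * 1"
    unfolding abs_mult using abs_q_power_le_1 by (intro mult_left_mono) auto
  ultimately show ?thesis unfolding meixner_b_def by linarith
qed

lemma meixner_l_le:
  assumes "0 \<le> \<tau>" "0 \<le> s" "s \<le> T" "0 \<le> t" "t \<le> T"
  shows "meixner_l \<tau> q s t n \<le> (2 * T + \<tau> * (2 / (1 - q))) * (2 / (1 - q))"
proof -
  have "\<bar>s * q ^ n\<bar> \<le> s * 1"
    unfolding abs_mult using abs_q_power_le_1 assms by (intro mult_mono) auto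
  moreover have "\<tau> * q_nat q n \<le> \<tau> * (2 / (1 - q))"
    using assms q_nat_le by (intro mult_left_mono) auto
  ultimately have "t - s * q ^ n + \<tau> * q_nat q n \<le> 2 * T + \<tau> * (2 / (1 - q))"
    using assms by linarith
  moreover have "0 \<le> 2 * T + \<tau> * (2 / (1 - q))" using assms q by (intro add_nonneg_nonneg) auto
  ultimately show ?thesis unfolding meixner_l_def
    using q_nat_le[of "n + 1"] q_nat_nonneg[of "n + 1"] by (intro mult_mono) auto
qed

text \<open>
  Positivity of all coefficients for \<open>s < t\<close>, and of all but the first one for \<open>s = t\<close>.
\<close>

lemma meixner_l_pos:
  assumes "0 \<le> \<tau>" "0 \<le> s" "s < t \<or> (s = t \<and> 0 < t \<and> 0 < n)"
  shows "0 < meixner_l \<tau> q s t n"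
proof -
  have le: "s * q ^ n \<le> s * 1"
    using abs_q_power_le_1[of n] assms by (intro mult_left_mono) auto
  have "s * q ^ n < t"
  proof (cases "s < t")
    case False
    then obtain m where "s = t" "0 < t" "n = Suc m" using assms by (cases n) auto
    then show ?thesis using abs_q_power_Suc_less_1[of m] mult_strict_left_mono[of "q ^ n" 1 t] by simp
  qed (use le in linarith)
  moreover have "0 \<le> \<tau> * q_nat q n" using assms q_nat_nonneg by simp
  ultimately show ?thesis unfolding meixner_l_def using q_nat_Suc_pos[of n]
    by (intro mult_pos_pos) auto
qed

lemma jacobi_bounded_meixner:
  assumes "0 \<le> \<tau>" "0 \<le> s" "s < t" "t \<le> T"
  shows "jacobi_bounded (meixner_b \<theta> q x) (meixner_l \<tau> q s t)
    (\<bar>\<theta>\<bar> * (2 / (1 - q)) + \<bar>x\<bar>) ((2 * T + \<tau> * (2 / (1 - q))) * (2 / (1 - q)))"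
  unfolding jacobi_bounded_def using assms abs_meixner_b_le meixner_l_le meixner_l_pos by auto

lemma jacobi_bounded_meixner_shift:
  assumes "0 \<le> \<tau>" "0 < t" "t \<le> T"
  shows "jacobi_bounded (\<lambda>n. meixner_b \<theta> q x (Suc n)) (\<lambda>n. meixner_l \<tau> q t t (Suc n))
    (\<bar>\<theta>\<bar> * (2 / (1 - q)) + \<bar>x\<bar>) ((2 * T + \<tau> * (2 / (1 - q))) * (2 / (1 - q)))"
  unfolding jacobi_bounded_def using assms abs_meixner_b_le meixner_l_le meixner_l_pos by auto

lemma trans_prob_jacobi_measure:
  assumes "0 \<le> \<tau>" "0 \<le> s" "s < t"
  shows "jacobi_measure (meixner_b \<theta> q x) (meixner_l \<tau> q s t) (trans_prob \<theta> \<tau> q s t x)"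
proof -
  have "Q_poly \<theta> \<tau> q x s t = jacobi_poly (meixner_b \<theta> q x) (meixner_l \<tau> q s t)"
    by (intro ext Q_poly_eq_jacobi_poly)
  then show ?thesis unfolding trans_prob_def
    using the_orthogonality_measure[OF jacobi_bounded_meixner[OF assms order_refl]] by simp
qed

lemma nu_measure_jacobi_measure:
  assumes "0 \<le> \<tau>" "0 < t"
  shows "jacobi_measure (\<lambda>n. meixner_b \<theta> q x (Suc n)) (\<lambda>n. meixner_l \<tau> q t t (Suc n)) (nu_measure \<theta> \<tau> q x t)"
proof -
  have "W_poly \<theta> \<tau> q x t = jacobi_poly (\<lambda>n. meixner_b \<theta> q x (Suc n)) (\<lambda>n. meixner_l \<tau> q t t (Suc n))"
    by (intro ext W_poly_eq_jacobi_poly)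
  then show ?thesis unfolding nu_measure_def
    using the_orthogonality_measure[OF jacobi_bounded_meixner_shift[OF assms order_refl]] by simp
qed

lemma meixner_b_0: "meixner_b \<theta> q x 0 = x"
  by (simp add: meixner_b_def q_nat_def)

lemma meixner_l_0: "meixner_l \<tau> q s t 0 = t - s"
  by (simp add: meixner_l_def q_nat_def)

lemma abs_trans_op_increment_le:
  assumes "0 \<le> \<tau>" "0 \<le> s" "s < t" and f: "twice_cont_diff f"
    and K: "\<And>y. \<bar>deriv (deriv f) y\<bar> \<le> K"
  shows "\<bar>trans_op \<theta> \<tau> q s t f x - f x\<bar> \<le> K / 2 * (t - s)"
  using abs_integral_increment_le[OF jacobi_bounded_meixner[OF assms(1-3) order_refl]
      trans_prob_jacobi_measure[OF assms(1-3)] f K, of \<theta> x]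
  by (simp add: trans_op_def meixner_b_0 meixner_l_0)

lemma trans_op_quotient_tendsto:
  assumes \<tau>: "0 \<le> \<tau>" and t: "0 < t" and f: "twice_cont_diff f"
    and s: "(s \<longlongrightarrow> t) F" and u: "(u \<longlongrightarrow> t) F"
    and su: "\<forall>\<^sub>F h in F. 0 \<le> s h \<and> s h < u h"
  shows "((\<lambda>h. (trans_op \<theta> \<tau> q (s h) (u h) f x - f x) / (u h - s h))
    \<longlongrightarrow> (LINT y|nu_measure \<theta> \<tau> q x t. taylor_quot f x y)) F"
proof -
  let ?b = "meixner_b \<theta> q x" and ?l = "\<lambda>h. meixner_l \<tau> q (s h) (u h)"
  let ?B = "\<bar>\<theta>\<bar> * (2 / (1 - q)) + \<bar>x\<bar>" and ?C = "(2 * (t + 1) + \<tau> * (2 / (1 - q))) * (2 / (1 - q))"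
  have "\<forall>\<^sub>F h in F. u h < t + 1" using u by (rule order_tendstoD) simp
  with su have "\<forall>\<^sub>F h in F. jacobi_bounded ?b (?l h) ?B ?C"
    by eventually_elim (use \<tau> in \<open>intro jacobi_bounded_meixner; simp\<close>)
  moreover have "\<forall>\<^sub>F h in F. jacobi_measure ?b (?l h) (trans_prob \<theta> \<tau> q (s h) (u h) x)"
    using su by eventually_elim (use \<tau> in \<open>auto intro: trans_prob_jacobi_measure\<close>)
  moreover have "((\<lambda>h. ?l h n) \<longlongrightarrow> meixner_l \<tau> q t t n) F" for n
    unfolding meixner_l_def by (intro tendsto_intros s u)
  ultimately have "((\<lambda>h. ((LINT y|trans_prob \<theta> \<tau> q (s h) (u h) x. f y) - f (?b 0)) / ?l h 0)
      \<longlongrightarrow> (LINT y|nu_measure \<theta> \<tau> q x t. taylor_quot f (?b 0) y)) F"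
    using jacobi_bounded_meixner_shift[OF \<tau> t, of "t + 1" \<theta> x] nu_measure_jacobi_measure[OF \<tau> t, of \<theta> x] f
    by (intro increment_quotient_tendsto[where B = ?B and C = ?C and k = "meixner_l \<tau> q t t"])
       (auto simp: meixner_l_0)
  then show ?thesis by (simp add: trans_op_def meixner_b_0 meixner_l_0)
qed

lemma left_quot_tendsto:
  assumes "0 \<le> \<tau>" "0 < t" "twice_cont_diff f"
  shows "((\<lambda>h. left_quot \<theta> \<tau> q t f h x) \<longlongrightarrow> (LINT y|nu_measure \<theta> \<tau> q x t. taylor_quot f x y)) (at_right 0)"
proof -
  have "((\<lambda>h. t - h) \<longlongrightarrow> t - 0) (at_right 0)" by (intro tendsto_intros)
  moreover have "\<forall>\<^sub>F h in at_right 0. 0 \<le> t - h \<and> t - h < t"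
    using eventually_at_right_less[of "0::real"] eventually_at_right_real[OF assms(2)]
    by eventually_elim auto
  ultimately show ?thesis
    using trans_op_quotient_tendsto[OF assms, of "\<lambda>h. t - h" "at_right 0" "\<lambda>_. t" \<theta> x]
    by (simp add: left_quot_def)
qed

lemma right_quot_tendsto:
  assumes "0 \<le> \<tau>" "0 < t" "twice_cont_diff f"
  shows "((\<lambda>h. right_quot \<theta> \<tau> q t f h x) \<longlongrightarrow> (LINT y|nu_measure \<theta> \<tau> q x t. taylor_quot f x y)) (at_right 0)"
proof -
  have "((\<lambda>h. t + h) \<longlongrightarrow> t + 0) (at_right 0)" by (intro tendsto_intros)
  moreover have "\<forall>\<^sub>F h in at_right 0. 0 \<le> t \<and> t < t + h"
    using eventually_at_right_less[of "0::real"] by eventually_elim (use assms in auto)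
  ultimately show ?thesis
    using trans_op_quotient_tendsto[OF assms, of "\<lambda>_. t" "at_right 0" "\<lambda>h. t + h" \<theta> x]
    by (simp add: right_quot_def)
qed

lemma left_gen_eq:
  assumes "0 \<le> \<tau>" "0 < t" "twice_cont_diff f"
  shows "left_gen \<theta> \<tau> q t f x = (LINT y|nu_measure \<theta> \<tau> q x t. taylor_quot f x y)"
  unfolding left_gen_def by (intro tendsto_Lim left_quot_tendsto assms) simp

lemma right_gen_eq:
  assumes "0 \<le> \<tau>" "0 < t" "twice_cont_diff f"
  shows "right_gen \<theta> \<tau> q t f x = (LINT y|nu_measure \<theta> \<tau> q x t. taylor_quot f x y)"
  unfolding right_gen_def by (intro tendsto_Lim right_quot_tendsto assms) simp

lemma integrable_taylor_quot:
  assumes "0 \<le> \<tau>" "0 < t" "twice_cont_diff f"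
  shows "integrable (nu_measure \<theta> \<tau> q x t) (taylor_quot f x)"
  by (rule integrable_jacobi_measure[OF jacobi_bounded_meixner_shift nu_measure_jacobi_measure])
     (use assms continuous_on_taylor_quot in auto)

text \<open>
  The atom of \<open>\<nu>\<close> at \<open>x\<close> contributes the diagonal value \<open>f''(x) / 2\<close> of the Taylor quotient.
\<close>

lemma gen_formula_eq:
  assumes "0 \<le> \<tau>" "0 < t" and f: "twice_cont_diff f"
  shows "set_integrable (nu_measure \<theta> \<tau> q x t) (- {x}) (dd_deriv f x)" (is ?A)
    and "gen_formula \<theta> \<tau> q t f x = (LINT y|nu_measure \<theta> \<tau> q x t. taylor_quot f x y)" (is ?B)
proof -
  let ?\<nu> = "nu_measure \<theta> \<tau> q x t" and ?g = "taylor_quot f x"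
  note \<nu> = nu_measure_jacobi_measure[OF assms(1,2), of \<theta> x]
  interpret real_distribution ?\<nu> by (rule jacobi_measureD(6)[OF \<nu>])
  have eq: "indicator (- {x}) y *\<^sub>R dd_deriv f x y = indicator (- {x}) y *\<^sub>R ?g y" for y
    using dd_deriv_eq_taylor_quot[OF f, of y x] by (cases "y = x") auto
  have int: "integrable ?\<nu> ?g" by (rule integrable_taylor_quot[OF assms])
  have int1: "integrable ?\<nu> (\<lambda>y. indicator (- {x}) y *\<^sub>R ?g y)"
    using int by (intro integrable_mult_indicator) auto
  then show ?A unfolding set_integrable_def eq .
  have "(LINT y|?\<nu>. ?g y) = (LINT y|?\<nu>. ?g x * indicator {x} y + indicator (- {x}) y *\<^sub>R ?g y)"
    by (intro Bochner_Integration.integral_cong) (auto split: split_indicator)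
  also have "\<dots> = (LINT y|?\<nu>. ?g x * indicator {x} y) + (LINT y|?\<nu>. indicator (- {x}) y *\<^sub>R ?g y)"
    by (intro Bochner_Integration.integral_add int1 integrable_mult_right) (simp add: emeasure_eq_measure)
  also have "(LINT y|?\<nu>. ?g x * indicator {x} y) = 1 / 2 * deriv (deriv f) x * measure ?\<nu> {x}"
    by (subst integral_mult_right_zero) (simp add: taylor_quot_def)
  finally show ?B unfolding gen_formula_def set_lebesgue_integral_def eq by simp
qed

end

lemma sup_norm_le:
  assumes "\<And>x. \<bar>g x\<bar> \<le> C"
  shows "sup_norm g \<le> ereal C"
  unfolding sup_norm_def by (rule SUP_least) (simp add: assms)

theorem theorem1p1:
  fixes \<theta> \<tau> q t :: real
  assumes "\<tau> \<ge> 0" and "- 1 < q" and "q < 1" and "t > 0"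
  shows "(\<forall>f :: real \<Rightarrow> real.
      continuous_on UNIV f \<and> bounded (range f) \<and>
      f differentiable_on UNIV \<and> deriv f differentiable_on UNIV \<and>
      continuous_on UNIV (deriv (deriv f)) \<and> bounded (range (deriv (deriv f)))
      \<longrightarrow>
      f \<in> left_dom \<theta> \<tau> q t \<inter> right_dom \<theta> \<tau> q t \<and>
      left_gen \<theta> \<tau> q t f = right_gen \<theta> \<tau> q t f \<and>
      (\<forall>x. set_integrable (nu_measure \<theta> \<tau> q x t) (- {x}) (dd_deriv f x) \<and>
           left_gen \<theta> \<tau> q t f x = gen_formula \<theta> \<tau> q t f x \<and>
           right_gen \<theta> \<tau> q t f x = gen_formula \<theta> \<tau> q t f x))
    \<and>
    (\<forall>f :: real poly.
      (\<forall>x. ((\<lambda>h. left_quot \<theta> \<tau> q t (poly f) h x) \<longlongrightarrow> left_gen \<theta> \<tau> q t (poly f) x) (at_right 0) \<and>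
           ((\<lambda>h. right_quot \<theta> \<tau> q t (poly f) h x) \<longlongrightarrow> right_gen \<theta> \<tau> q t (poly f) x) (at_right 0)) \<and>
      left_gen \<theta> \<tau> q t (poly f) = right_gen \<theta> \<tau> q t (poly f) \<and>
      (\<forall>x. set_integrable (nu_measure \<theta> \<tau> q x t) (- {x}) (dd_deriv (poly f) x) \<and>
           left_gen \<theta> \<tau> q t (poly f) x = gen_formula \<theta> \<tau> q t (poly f) x \<and>
           integrable (nu_measure \<theta> \<tau> q x t) (dd_poly_deriv f x) \<and>
           left_gen \<theta> \<tau> q t (poly f) x = (LINT y|nu_measure \<theta> \<tau> q x t. dd_poly_deriv f x y)))"
proof (intro conjI)
  note ql = assms(2,3) and \<tau> = assms(1) and t = assms(4)
  note gens = left_gen_eq[OF ql \<tau> t] right_gen_eq[OF ql \<tau> t] gen_formula_eq[OF ql \<tau> t]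
  show "\<forall>f :: real \<Rightarrow> real.
      continuous_on UNIV f \<and> bounded (range f) \<and>
      f differentiable_on UNIV \<and> deriv f differentiable_on UNIV \<and>
      continuous_on UNIV (deriv (deriv f)) \<and> bounded (range (deriv (deriv f)))
      \<longrightarrow>
      f \<in> left_dom \<theta> \<tau> q t \<inter> right_dom \<theta> \<tau> q t \<and>
      left_gen \<theta> \<tau> q t f = right_gen \<theta> \<tau> q t f \<and>
      (\<forall>x. set_integrable (nu_measure \<theta> \<tau> q x t) (- {x}) (dd_deriv f x) \<and>
           left_gen \<theta> \<tau> q t f x = gen_formula \<theta> \<tau> q t f x \<and>
           right_gen \<theta> \<tau> q t f x = gen_formula \<theta> \<tau> q t f x)"
  proof (intro allI impI)
    fix f :: "real \<Rightarrow> real"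
    assume A: "continuous_on UNIV f \<and> bounded (range f) \<and>
      f differentiable_on UNIV \<and> deriv f differentiable_on UNIV \<and>
      continuous_on UNIV (deriv (deriv f)) \<and> bounded (range (deriv (deriv f)))"
    then have f: "twice_cont_diff f"
      by (auto simp: twice_cont_diff_def differentiable_on_def DERIV_deriv_iff_real_differentiable)
    obtain K where K: "\<And>y. \<bar>deriv (deriv f) y\<bar> \<le> K"
      using A by (auto simp: bounded_iff)
    have quot: "\<bar>(1 / h) * d\<bar> \<le> K / 2" if "\<bar>d\<bar> \<le> K / 2 * h" "0 < h" for h d :: real
      using that by (simp add: abs_mult field_simps)
    have "sup_norm (left_quot \<theta> \<tau> q t f h) \<le> ereal (K / 2)" if "h \<in> {0<..t}" for h
      unfolding left_quot_def
      by (intro sup_norm_le quot) (use that abs_trans_op_increment_le[OF ql \<tau> _ _ f K, of "t - h" t] in auto)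
    moreover have "sup_norm (right_quot \<theta> \<tau> q t f h) \<le> ereal (K / 2)" if "h \<in> {0<..}" for h
      unfolding right_quot_def
      by (intro sup_norm_le quot) (use that t abs_trans_op_increment_le[OF ql \<tau> _ _ f K, of t "t + h"] in auto)
    ultimately have "f \<in> left_dom \<theta> \<tau> q t \<inter> right_dom \<theta> \<tau> q t"
      using A left_quot_tendsto[OF ql \<tau> t f] right_quot_tendsto[OF ql \<tau> t f]
      unfolding left_dom_def right_dom_def by blast
    then show "f \<in> left_dom \<theta> \<tau> q t \<inter> right_dom \<theta> \<tau> q t \<and>
      left_gen \<theta> \<tau> q t f = right_gen \<theta> \<tau> q t f \<and>
      (\<forall>x. set_integrable (nu_measure \<theta> \<tau> q x t) (- {x}) (dd_deriv f x) \<and>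
           left_gen \<theta> \<tau> q t f x = gen_formula \<theta> \<tau> q t f x \<and>
           right_gen \<theta> \<tau> q t f x = gen_formula \<theta> \<tau> q t f x)"
      using gens[OF f] by (simp add: fun_eq_iff)
  qed
next
  note ql = assms(2,3) and \<tau> = assms(1) and t = assms(4)
  show "\<forall>f :: real poly.
      (\<forall>x. ((\<lambda>h. left_quot \<theta> \<tau> q t (poly f) h x) \<longlongrightarrow> left_gen \<theta> \<tau> q t (poly f) x) (at_right 0) \<and>
           ((\<lambda>h. right_quot \<theta> \<tau> q t (poly f) h x) \<longlongrightarrow> right_gen \<theta> \<tau> q t (poly f) x) (at_right 0)) \<and>
      left_gen \<theta> \<tau> q t (poly f) = right_gen \<theta> \<tau> q t (poly f) \<and>
      (\<forall>x. set_integrable (nu_measure \<theta> \<tau> q x t) (- {x}) (dd_deriv (poly f) x) \<and>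
           left_gen \<theta> \<tau> q t (poly f) x = gen_formula \<theta> \<tau> q t (poly f) x \<and>
           integrable (nu_measure \<theta> \<tau> q x t) (dd_poly_deriv f x) \<and>
           left_gen \<theta> \<tau> q t (poly f) x = (LINT y|nu_measure \<theta> \<tau> q x t. dd_poly_deriv f x y))"
  proof
    fix f :: "real poly"
    note p = twice_cont_diff_poly[of f]
    have dd: "dd_poly_deriv f x = taylor_quot (poly f) x" for x
      by (intro ext dd_poly_deriv_eq_taylor_quot)
    show "(\<forall>x. ((\<lambda>h. left_quot \<theta> \<tau> q t (poly f) h x) \<longlongrightarrow> left_gen \<theta> \<tau> q t (poly f) x) (at_right 0) \<and>
           ((\<lambda>h. right_quot \<theta> \<tau> q t (poly f) h x) \<longlongrightarrow> right_gen \<theta> \<tau> q t (poly f) x) (at_right 0)) \<and>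
      left_gen \<theta> \<tau> q t (poly f) = right_gen \<theta> \<tau> q t (poly f) \<and>
      (\<forall>x. set_integrable (nu_measure \<theta> \<tau> q x t) (- {x}) (dd_deriv (poly f) x) \<and>
           left_gen \<theta> \<tau> q t (poly f) x = gen_formula \<theta> \<tau> q t (poly f) x \<and>
           integrable (nu_measure \<theta> \<tau> q x t) (dd_poly_deriv f x) \<and>
           left_gen \<theta> \<tau> q t (poly f) x = (LINT y|nu_measure \<theta> \<tau> q x t. dd_poly_deriv f x y))"
      using left_quot_tendsto[OF ql \<tau> t p] right_quot_tendsto[OF ql \<tau> t p]
        integrable_taylor_quot[OF ql \<tau> t p] gen_formula_eq[OF ql \<tau> t p]
      by (simp add: left_gen_eq[OF ql \<tau> t p] right_gen_eq[OF ql \<tau> t p] dd fun_eq_iff)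
  qed
qed

end
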